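(* Assume $F$ is uniformly convex of degree three with parameter $\sigma_3>0$: $F(y) \ge F(x) + \langle F'(x), y - x\rangle + \frac{\sigma_3}{3}\|y-x\|^3$ for all $x,y\in\mathrm{dom}\,\psi$ and all $F'(x)\in\partial F(x)$. Consider the method: choose $H \ge L_2$, $x_0 \in \mathrm{dom}\,\psi$ and $F'_0 \in \partial F(x_0)$; for $k \ge 0$ set $g_k = \|F'_k\|_*$, $A_k = \frac{1}{\sigma}\sqrt{\frac{H}{3}g_k}$, $x_{k+1} = T_{A_k}(x_k)$, and $$F'_{k+1} = \nabla f(x_{k+1}) - \nabla f(x_k) - \nabla^2 f(x_k)(x_{k+1} - x_k) - A_k(\nabla d(x_{k+1}) - \nabla d(x_k)).$$ Let $x^*$ be the minimizer of $F$, $F^*=F(x^* )$, and $D = \sup_{x\in\mathrm{dom}\,\psi}\{\|x - x^*\| : F(x)\le F(x_0)\}$. Then for all $k\ge 0$, $$F(x_k) - F^* \;\le\; D\,\|F'_0\|_*\cdot \exp\left(-\frac{k\ln(1+S)}{c^{1/2} + \frac12\ln(1+S)}\right),$$ where $c = \sigma^{-1} + \frac{3L_2}{2H}$ and $S = \frac{3\sqrt3}{4c^{3/2}}\sqrt{\frac{\sigma_3}{H}}$.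
   Context: $\mathbb{E}$ is a finite-dimensional real vector space with an arbitrary norm $\|\cdot\|$; $\mathbb{E}^*$ is its dual with dual norm $\|g\|_* = \max\{\langle g, x\rangle : \|x\|\le 1\}$; for a self-adjoint linear operator $B:\mathbb{E}\to\mathbb{E}^*$, $\|B\| = \max\{|\langle Bx,x\rangle| : \|x\|\le 1\}$. $F = f + \psi$, where $\psi$ is a closed convex function with $\mathrm{dom}\,\psi \subseteq \mathbb{E}$ and $f$ is convex and twice continuously differentiable with $\|\nabla^2 f(x) - \nabla^2 f(y)\| \le L_2\|x-y\|$ for all $x,y\in\mathrm{dom}\,\psi$. The scaling function $d$ is differentiable and satisfies, for some $\sigma\in(0,1]$ and all $x,y \in \mathrm{dom}\,\psi$: $d(y) \ge d(x) + \langle \nabla d(x), y-x\rangle + \frac{\sigma}{2}\|y-x\|^2$ and $\|\nabla d(x) - \nabla d(y)\|_* \le \|x-y\|$. Bregman distance: $\rho(x,y) = d(y) - d(x) - \langle \nabla d(x), y-x\rangle$. For $\bar x\in\mathrm{dom}\,\psi$ and $A>0$, $$T_A(\bar x) = \arg\min_{y\in\mathrm{dom}\,\psi}\Big[ f(\bar x) + \langle \nabla f(\bar x), y-\bar x\rangle + \tfrac12 \langle \nabla^2 f(\bar x)(y-\bar x), y-\bar x\rangle + A\rho(\bar x,y) + \psi(y)\Big].$$ *)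

theory Defs
  imports "HOL-Analysis.Analysis"
begin

text \<open>The space E is modelled by a Euclidean type 'a; the dual space E* is identified
with 'a via the inner product, so that the pairing of g with x is g \<bullet> x.
The norm of E is an arbitrary norm nrm (not necessarily the Euclidean one).\<close>

definition is_norm :: "('a::real_vector \<Rightarrow> real) \<Rightarrow> bool" where
  "is_norm nrm \<longleftrightarrow>
     (\<forall>x. nrm x = 0 \<longleftrightarrow> x = 0) \<and>
     (\<forall>x y. nrm (x + y) \<le> nrm x + nrm y) \<and>
     (\<forall>c x. nrm (c *\<^sub>R x) = \<bar>c\<bar> * nrm x)"

definition dual_norm :: "('a::real_inner \<Rightarrow> real) \<Rightarrow> 'a \<Rightarrow> real" where
  "dual_norm nrm g = Sup {g \<bullet> x | x. nrm x \<le> 1}"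

text \<open>Norm of a self-adjoint operator B : E \<rightarrow> E*.\<close>
definition op_norm_sa :: "('a::real_inner \<Rightarrow> real) \<Rightarrow> ('a \<Rightarrow> 'a) \<Rightarrow> real" where
  "op_norm_sa nrm B = Sup {\<bar>B x \<bullet> x\<bar> | x. nrm x \<le> 1}"

text \<open>Subdifferential of F (defined on the set Q = dom psi) at x.\<close>
definition subdiff :: "'a::real_inner set \<Rightarrow> ('a \<Rightarrow> real) \<Rightarrow> 'a \<Rightarrow> 'a set" where
  "subdiff Q F x = {g. \<forall>y\<in>Q. F y \<ge> F x + g \<bullet> (y - x)}"

definition bregman :: "('a::real_inner \<Rightarrow> real) \<Rightarrow> ('a \<Rightarrow> 'a) \<Rightarrow> 'a \<Rightarrow> 'a \<Rightarrow> real" where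
  "bregman d gd x y = d y - d x - gd x \<bullet> (y - x)"

definition model ::
  "('a::real_inner \<Rightarrow> real) \<Rightarrow> ('a \<Rightarrow> 'a) \<Rightarrow> ('a \<Rightarrow> 'a \<Rightarrow> 'a) \<Rightarrow>
   ('a \<Rightarrow> real) \<Rightarrow> ('a \<Rightarrow> 'a) \<Rightarrow> ('a \<Rightarrow> real) \<Rightarrow> real \<Rightarrow> 'a \<Rightarrow> 'a \<Rightarrow> real" where
  "model f gf hf d gd psi A xb y =
     f xb + gf xb \<bullet> (y - xb) + 1/2 * (hf xb (y - xb) \<bullet> (y - xb))
     + A * bregman d gd xb y + psi y"

text \<open>y = T_A(xb): y is the minimizer over Q of the model (unique when A > 0).\<close>
definition is_T ::
  "'a::real_inner set \<Rightarrow> ('a \<Rightarrow> real) \<Rightarrow> ('a \<Rightarrow> 'a) \<Rightarrow> ('a \<Rightarrow> 'a \<Rightarrow> 'a) \<Rightarrow>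
   ('a \<Rightarrow> real) \<Rightarrow> ('a \<Rightarrow> 'a) \<Rightarrow> ('a \<Rightarrow> real) \<Rightarrow> real \<Rightarrow> 'a \<Rightarrow> 'a \<Rightarrow> bool" where
  "is_T Q f gf hf d gd psi A xb y \<longleftrightarrow>
     y \<in> Q \<and> (\<forall>z\<in>Q. model f gf hf d gd psi A xb y \<le> model f gf hf d gd psi A xb z)"

end

theory Submission
  imports Defs
begin

text \<open>Write g_k for the dual norm of F'_k, r_k for the length of step k and a_k for A_k * \<sigma>. Optimality of
  the step gives a_k r_k \<le> g_k and F(x_k) - F(x_{k+1}) \<ge> a_k r_k^2 - L2 r_k^3 / 6, and uniform convexity
  bounds the gap E_k = F(x_k) - F* by a multiple of |F'_k|^{3/2}. Together they give
  ln (E_k / E_{k+1}) \<ge> M (1 + ln (m_{k+1} / m_k) / 2) with M = ln (1+S) / c^{1/2}, where m_k measures F'_k.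
  Summing, and using E_k \<le> D m_k, the quantity X = ln (D g_0 / E_k) satisfies X \<ge> M (k - X / 2), which is
  the claimed rate.

  One cannot simply take m_k = g_k. The Hessian is Lipschitz in the norm sup |B v v|, and for a non-Euclidean
  norm this controls the bilinear form B u v only up to a factor 2. The sharp bound
  |grad f(y) - grad f(x) - hess f(x) (y - x)| \<le> L2 r^2 / 2 is therefore available only along differences
  of points of Q, which need not span the space. We take m_{k+1} = L2 r_k^2 / 2 + A_k r_k, a bound for F'_{k+1} in
  those directions, which are the only ones entering the estimates, and use g_{k+1} \<le> 2 m_{k+1} elsewhere.\<close>

subsection \<open>Norms and dual norms\<close>

lemma is_norm_zero: "is_norm nrm \<Longrightarrow> nrm 0 = 0"
  by (simp add: is_norm_def)

lemma is_norm_eq_zero_iff: "is_norm nrm \<Longrightarrow> nrm x = 0 \<longleftrightarrow> x = 0"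
  by (simp add: is_norm_def)

lemma is_norm_triangle: "is_norm nrm \<Longrightarrow> nrm (x + y) \<le> nrm x + nrm y"
  by (simp add: is_norm_def)

lemma is_norm_scaleR: "is_norm nrm \<Longrightarrow> nrm (c *\<^sub>R x) = \<bar>c\<bar> * nrm x"
  by (simp add: is_norm_def)

lemma is_norm_minus: "is_norm nrm \<Longrightarrow> nrm (- x) = nrm x"
  using is_norm_scaleR[of nrm "-1" x] by simp

lemma is_norm_minus_commute: "is_norm nrm \<Longrightarrow> nrm (x - y) = nrm (y - x)"
  using is_norm_minus[of nrm "x - y"] by simp

lemma is_norm_nonneg: "is_norm nrm \<Longrightarrow> 0 \<le> nrm x"
  using is_norm_triangle[of nrm x "- x"] is_norm_minus[of nrm x] is_norm_zero[of nrm] by simp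

lemma is_norm_pos: "is_norm nrm \<Longrightarrow> x \<noteq> 0 \<Longrightarrow> 0 < nrm x"
  using is_norm_nonneg[of nrm x] is_norm_eq_zero_iff[of nrm x] by linarith

lemma is_norm_normalize: "is_norm nrm \<Longrightarrow> x \<noteq> 0 \<Longrightarrow> nrm ((1 / nrm x) *\<^sub>R x) = 1"
  using is_norm_pos[of nrm x] by (simp add: is_norm_scaleR)

lemma is_norm_convex_on: "is_norm nrm \<Longrightarrow> convex_on UNIV nrm"
proof (rule convex_onI)
  fix t :: real and x y assume n: "is_norm nrm" and t: "0 < t" "t < 1"
  show "nrm ((1 - t) *\<^sub>R x + t *\<^sub>R y) \<le> (1 - t) * nrm x + t * nrm y"
    using is_norm_triangle[OF n, of "(1 - t) *\<^sub>R x" "t *\<^sub>R y"] t by (simp add: is_norm_scaleR[OF n])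
qed simp

text \<open>\<open>nrm\<close> is convex, hence continuous, and has a positive minimum on the
  compact Euclidean unit sphere. This comparison bounds the sets under the suprema in
  \<open>dual_norm\<close> and \<open>op_norm_sa\<close>, so that \<open>Sup\<close> really is a
  least upper bound there.\<close>

lemma norm_le_is_norm:
  fixes nrm :: "'a::euclidean_space \<Rightarrow> real"
  assumes n: "is_norm nrm"
  obtains C where "C > 0" "\<And>x. norm x \<le> C * nrm x"
proof -
  have cont: "continuous_on (sphere 0 1) nrm"
    using convex_on_continuous[OF open_UNIV is_norm_convex_on[OF n]] continuous_on_subset by blast
  obtain b :: 'a where b: "norm b = 1"
    using vector_choose_size[of 1] by auto
  then have "sphere (0::'a) 1 \<noteq> {}" by auto
  from continuous_attains_inf[OF compact_sphere this cont]
  obtain x0 where x0: "norm x0 = 1" "\<And>y. norm y = 1 \<Longrightarrow> nrm x0 \<le> nrm y" by auto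
  have pos: "nrm x0 > 0" using x0(1) by (intro is_norm_pos[OF n]) auto
  have "norm x \<le> (1 / nrm x0) * nrm x" for x
  proof (cases "x = 0")
    case False
    then have "norm ((1 / norm x) *\<^sub>R x) = 1" by simp
    from x0(2)[OF this] have "nrm x0 \<le> nrm x / norm x" by (simp add: is_norm_scaleR[OF n])
    then show ?thesis using pos False by (simp add: field_simps)
  qed (simp add: is_norm_zero[OF n])
  then show ?thesis using that[of "1 / nrm x0"] pos by simp
qed

lemma inner_le_dual_norm:
  fixes nrm :: "'a::euclidean_space \<Rightarrow> real"
  assumes n: "is_norm nrm"
  shows "g \<bullet> v \<le> dual_norm nrm g * nrm v"
proof (cases "v = 0")
  case False
  obtain C where C: "C > 0" "\<And>x. norm x \<le> C * nrm x" using norm_le_is_norm[OF n] by blast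
  have bdd: "bdd_above {g \<bullet> x | x. nrm x \<le> 1}"
  proof (rule bdd_aboveI[of _ "norm g * C"], clarify)
    fix x assume "nrm x \<le> 1"
    then have "norm x \<le> C" using C(1) C(2)[of x] by (metis mult.right_neutral mult_left_mono order_less_imp_le order_trans)
    then show "g \<bullet> x \<le> norm g * C"
      by (meson Cauchy_Schwarz_ineq2 abs_le_D1 mult_left_mono norm_ge_zero order_trans)
  qed
  have "g \<bullet> ((1 / nrm v) *\<^sub>R v) \<le> dual_norm nrm g" unfolding dual_norm_def
    by (rule cSup_upper[OF _ bdd], rule CollectI, rule exI[of _ "(1 / nrm v) *\<^sub>R v"])
      (simp only: is_norm_normalize[OF n False] order_refl)
  then show ?thesis using is_norm_pos[OF n False] by (simp add: field_simps)
qed (simp add: is_norm_zero[OF n])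

lemma dual_norm_le:
  fixes nrm :: "'a::real_inner \<Rightarrow> real"
  assumes n: "is_norm nrm" and K: "K \<ge> 0" and le: "\<And>v. g \<bullet> v \<le> K * nrm v"
  shows "dual_norm nrm g \<le> K"
  unfolding dual_norm_def
proof (rule cSup_least)
  show "{g \<bullet> x | x. nrm x \<le> 1} \<noteq> {}" using is_norm_zero[OF n] by (auto intro!: exI[of _ 0])
  show "a \<le> K" if "a \<in> {g \<bullet> x | x. nrm x \<le> 1}" for a
    using that le K by (auto intro: order_trans[OF le mult_left_le])
qed

lemma dual_norm_nonneg:
  fixes nrm :: "'a::euclidean_space \<Rightarrow> real"
  assumes n: "is_norm nrm"
  shows "0 \<le> dual_norm nrm g"
proof -
  obtain b :: 'a where "norm b = 1" using vector_choose_size[of 1] by auto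
  then have b: "nrm b > 0" by (intro is_norm_pos[OF n]) auto
  have "0 \<le> dual_norm nrm g * nrm b"
    using inner_le_dual_norm[OF n, of g b] inner_le_dual_norm[OF n, of g "- b"] by (simp add: is_norm_minus[OF n])
  then show ?thesis using b by (simp add: zero_le_mult_iff)
qed

lemma dual_norm_eq_zeroD:
  fixes nrm :: "'a::euclidean_space \<Rightarrow> real"
  assumes "is_norm nrm" "dual_norm nrm g = 0"
  shows "g = 0"
  using inner_le_dual_norm[OF assms(1), of g g] assms(2) inner_ge_zero[of g] inner_eq_zero_iff[of g] by simp

lemma quadratic_form_le_op_norm_sa:
  fixes nrm :: "'a::euclidean_space \<Rightarrow> real"
  assumes n: "is_norm nrm" and B: "bounded_linear B"
  shows "\<bar>B v \<bullet> v\<bar> \<le> op_norm_sa nrm B * (nrm v)\<^sup>2"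
proof (cases "v = 0")
  case False
  obtain C where C: "C > 0" "\<And>x. norm x \<le> C * nrm x" using norm_le_is_norm[OF n] by blast
  obtain K where K: "K > 0" "\<And>x. norm (B x) \<le> norm x * K"
    using bounded_linear.pos_bounded[OF B] by blast
  have bdd: "bdd_above {\<bar>B x \<bullet> x\<bar> | x. nrm x \<le> 1}"
  proof (rule bdd_aboveI[of _ "(C * K) * C"], clarify)
    fix x assume "nrm x \<le> 1"
    then have x: "norm x \<le> C" using C(1) C(2)[of x] by (metis mult.right_neutral mult_left_mono order_less_imp_le order_trans)
    have "\<bar>B x \<bullet> x\<bar> \<le> norm (B x) * norm x" by (rule Cauchy_Schwarz_ineq2)
    also have "\<dots> \<le> (norm x * K) * norm x" using K(2)[of x] by (simp add: mult_right_mono)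
    also have "\<dots> \<le> (C * K) * C" using x K(1) C(1) by (intro mult_mono) auto
    finally show "\<bar>B x \<bullet> x\<bar> \<le> (C * K) * C" .
  qed
  let ?u = "(1 / nrm v) *\<^sub>R v"
  have "\<bar>B ?u \<bullet> ?u\<bar> \<le> op_norm_sa nrm B" unfolding op_norm_sa_def
    by (rule cSup_upper[OF _ bdd], rule CollectI, rule exI[of _ ?u])
      (simp only: is_norm_normalize[OF n False] order_refl)
  also have "B ?u \<bullet> ?u = (B v \<bullet> v) / (nrm v)\<^sup>2"
    by (simp add: linear_simps(5)[OF B] power2_eq_square)
  finally have "\<bar>B v \<bullet> v\<bar> / (nrm v)\<^sup>2 \<le> op_norm_sa nrm B" by simp
  then show ?thesis using is_norm_pos[OF n False] by (simp add: pos_divide_le_eq)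
next
  case True
  then show ?thesis by (simp add: is_norm_zero[OF n])
qed

text \<open>The factor 2 is the polarization constant; it cannot be improved for a general norm.\<close>

lemma polarization_bound:
  fixes B :: "'a::real_inner \<Rightarrow> 'a"
  assumes n: "is_norm nrm" and B: "linear B" and sym: "\<And>u v. B u \<bullet> v = B v \<bullet> u"
    and q: "\<And>w. \<bar>B w \<bullet> w\<bar> \<le> K * (nrm w)\<^sup>2"
  shows "B u \<bullet> v \<le> 2 * K * nrm u * nrm v"
proof (cases "u = 0 \<or> v = 0")
  case True
  then show ?thesis by (auto simp: linear_0[OF B] is_norm_zero[OF n])
next
  case False
  let ?a = "(1 / nrm u) *\<^sub>R u" and ?b = "(1 / nrm v) *\<^sub>R v"
  have nu: "nrm ?a = 1" and nv: "nrm ?b = 1" using False by (auto intro!: is_norm_normalize[OF n])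
  have K: "K \<ge> 0" using order_trans[OF abs_ge_zero q[of ?a]] unfolding nu by simp
  have "nrm (?a + ?b) \<le> 2" "nrm (?a - ?b) \<le> 2"
    using is_norm_triangle[OF n, of ?a ?b] is_norm_triangle[OF n, of ?a "- ?b"] is_norm_minus[OF n, of ?b] nu nv
    by auto
  from this[THEN power_mono[OF _ is_norm_nonneg[OF n], of _ _ 2]]
  have k: "K * (nrm (?a + ?b))\<^sup>2 \<le> K * 4" "K * (nrm (?a - ?b))\<^sup>2 \<le> K * 4"
    using K by (auto intro: mult_left_mono)
  \<comment> \<open>Polarization identity. The sum and the difference of the two unit vectors have
    norm at most 2, so each quadratic form is at most \<open>4 * K\<close> in absolute
    value.\<close>
  have "4 * (B ?a \<bullet> ?b) = B (?a + ?b) \<bullet> (?a + ?b) - B (?a - ?b) \<bullet> (?a - ?b)"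
    using sym[of ?b ?a] by (simp only: linear_add[OF B] linear_diff[OF B] inner_add inner_diff)
  also have "\<dots> \<le> 8 * K" using q[of "?a + ?b"] q[of "?a - ?b"] k by linarith
  finally have *: "B ?a \<bullet> ?b \<le> 2 * K" by simp
  have "B ?a \<bullet> ?b = (B u \<bullet> v) / (nrm u * nrm v)" by (simp add: linear_cmul[OF B])
  then show ?thesis using * is_norm_pos[OF n, of u] is_norm_pos[OF n, of v] False
    by (simp add: field_simps)
qed

subsection \<open>Derivatives and convexity\<close>

lemma has_real_derivative_along_line:
  assumes "\<And>y. (f has_derivative (\<lambda>h. gf y \<bullet> h)) (at y)"
  shows "((\<lambda>s. f (a + s *\<^sub>R b)) has_real_derivative gf (a + s *\<^sub>R b) \<bullet> b) (at s)"
proof -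
  have "((\<lambda>s. a + s *\<^sub>R b) has_derivative (\<lambda>t. t *\<^sub>R b)) (at s)"
    by (auto intro!: derivative_eq_intros)
  from has_derivative_compose[OF this assms]
  show ?thesis by (simp add: has_field_derivative_def mult_commute_abs)
qed

lemma has_real_derivative_inner_along_line:
  fixes gf :: "'a::real_inner \<Rightarrow> 'a"
  assumes "\<And>y. (gf has_derivative hf y) (at y)"
  shows "((\<lambda>s. gf (a + s *\<^sub>R b) \<bullet> v) has_real_derivative hf (a + s *\<^sub>R b) b \<bullet> v) (at s)"
proof -
  have "((\<lambda>s. a + s *\<^sub>R b) has_derivative (\<lambda>t. t *\<^sub>R b)) (at s)"
    by (auto intro!: derivative_eq_intros)
  from has_derivative_inner_left[OF has_derivative_compose[OF this assms], of v]
  show ?thesis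
    using linear_cmul[OF has_derivative_linear[OF assms]]
    by (simp add: has_field_derivative_def mult_commute_abs)
qed

text \<open>The right-hand difference quotients at 0 are at most \<open>K\<close>, hence so is their
  limit. One-sided increments are all that is available when a point can move only into
  \<open>Q\<close>.\<close>

lemma derivative_le_of_increment_le:
  fixes R :: "real \<Rightarrow> real"
  assumes der: "(R has_real_derivative D) (at 0)" and e: "e > 0"
    and le: "\<And>s. 0 < s \<Longrightarrow> s < e \<Longrightarrow> R s - R 0 \<le> s * K"
  shows "D \<le> K"
proof (rule tendsto_upperbound)
  show "((\<lambda>s. (R s - R 0) / s) \<longlongrightarrow> D) (at_right 0)"
    using der by (simp add: has_field_derivative_iff filterlim_at_split)
  show "\<forall>\<^sub>F s in at_right 0. (R s - R 0) / s \<le> K"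
    using eventually_at_right_real[OF e] by eventually_elim (use le in \<open>auto simp: field_simps\<close>)
qed simp

text \<open>The mean value theorem is applied twice: along \<open>u\<close> to the difference of
  \<open>f\<close> on two parallel lines, then along \<open>v\<close> to the gradient.\<close>

lemma second_difference_eq:
  fixes f :: "'a::real_inner \<Rightarrow> real"
  assumes fg: "\<And>y. (f has_derivative (\<lambda>h. gf y \<bullet> h)) (at y)"
    and fh: "\<And>y. (gf has_derivative hf y) (at y)" and s: "s > 0"
  obtains p q where "0 \<le> p" "p \<le> s" "0 \<le> q" "q \<le> s"
    "f (x + s *\<^sub>R u + s *\<^sub>R v) - f (x + s *\<^sub>R u) - f (x + s *\<^sub>R v) + f x
      = s\<^sup>2 * (hf (x + p *\<^sub>R u + q *\<^sub>R v) v \<bullet> u)"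
proof -
  let ?w = "\<lambda>t. f ((x + s *\<^sub>R v) + t *\<^sub>R u) - f (x + t *\<^sub>R u)"
  have "\<exists>p>0. p < s \<and> ?w s - ?w 0 = (s - 0) * (gf ((x + s *\<^sub>R v) + p *\<^sub>R u) \<bullet> u - gf (x + p *\<^sub>R u) \<bullet> u)"
    by (rule MVT2[OF s]) (intro DERIV_diff has_real_derivative_along_line fg)
  then obtain p where p: "0 < p" "p < s"
    "?w s - ?w 0 = s * (gf ((x + s *\<^sub>R v) + p *\<^sub>R u) \<bullet> u - gf (x + p *\<^sub>R u) \<bullet> u)" by auto
  let ?z = "\<lambda>t. gf ((x + p *\<^sub>R u) + t *\<^sub>R v) \<bullet> u"
  have "\<exists>q>0. q < s \<and> ?z s - ?z 0 = (s - 0) * (hf ((x + p *\<^sub>R u) + q *\<^sub>R v) v \<bullet> u)"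
    by (rule MVT2[OF s]) (intro has_real_derivative_inner_along_line fh)
  then obtain q where q: "0 < q" "q < s" "?z s - ?z 0 = s * (hf ((x + p *\<^sub>R u) + q *\<^sub>R v) v \<bullet> u)" by auto
  have "?w s - ?w 0 = s * (?z s - ?z 0)" using p(3) by (simp add: algebra_simps)
  then have "?w s - ?w 0 = s\<^sup>2 * (hf (x + p *\<^sub>R u + q *\<^sub>R v) v \<bullet> u)"
    using q(3) by (simp add: power2_eq_square)
  then show ?thesis using that[of p q] p q by (simp add: algebra_simps)
qed

text \<open>Schwarz's theorem. The four-point second difference does not change when
  \<open>u\<close> and \<open>v\<close> are swapped, so the mixed Hessian values at two points near
  \<open>x\<close> agree, and continuity moves both points to \<open>x\<close>.\<close>

lemma hessian_symmetric:
  fixes f :: "'a::real_inner \<Rightarrow> real"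
  assumes fg: "\<And>y. (f has_derivative (\<lambda>h. gf y \<bullet> h)) (at y)"
    and fh: "\<And>y. (gf has_derivative hf y) (at y)"
    and cont: "\<And>v. continuous_on UNIV (\<lambda>y. hf y v)"
  shows "hf x u \<bullet> v = hf x v \<bullet> u"
proof -
  have cont': "isCont (\<lambda>y. hf y a \<bullet> b) x" for a b
    using cont[of a] by (intro continuous_inner continuous_const) (simp add: continuous_on_eq_continuous_at)
  have "\<bar>hf x u \<bullet> v - hf x v \<bullet> u\<bar> \<le> 2 * e" if e: "e > 0" for e
  proof -
    obtain d1 where d1: "d1 > 0" "\<And>y. dist y x < d1 \<Longrightarrow> \<bar>hf y v \<bullet> u - hf x v \<bullet> u\<bar> < e"
      using cont'[of v u] e unfolding continuous_at_eps_delta dist_real_def by blast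
    obtain d2 where d2: "d2 > 0" "\<And>y. dist y x < d2 \<Longrightarrow> \<bar>hf y u \<bullet> v - hf x u \<bullet> v\<bar> < e"
      using cont'[of u v] e unfolding continuous_at_eps_delta dist_real_def by blast
    define N where "N = norm u + norm v + 1"
    have N: "N > 0" by (simp add: N_def add_nonneg_pos)
    \<comment> \<open>With this \<open>s\<close> the parallelogram at \<open>x\<close> with sides
      \<open>s *\<^sub>R u\<close> and \<open>s *\<^sub>R v\<close> lies in both neighbourhoods of
      continuity.\<close>
    define s where "s = min d1 d2 / N"
    have s: "s > 0" using d1(1) d2(1) N by (simp add: s_def)
    have near: "dist (x + p *\<^sub>R a + q *\<^sub>R b) x < min d1 d2"
      if "0 \<le> p" "p \<le> s" "0 \<le> q" "q \<le> s" "norm a + norm b + 1 = N" for p q a b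
    proof -
      have "dist (x + p *\<^sub>R a + q *\<^sub>R b) x = norm (p *\<^sub>R a + q *\<^sub>R b)"
        by (simp add: dist_norm algebra_simps)
      also have "\<dots> \<le> p * norm a + q * norm b" using that norm_triangle_ineq[of "p *\<^sub>R a" "q *\<^sub>R b"] by simp
      also have "\<dots> \<le> s * norm a + s * norm b" using that by (intro add_mono mult_right_mono) auto
      also have "\<dots> < s * N" using s that(5)[symmetric] by (simp add: algebra_simps)
      also have "\<dots> = min d1 d2" using N by (simp add: s_def)
      finally show ?thesis .
    qed
    obtain p q where pq: "0 \<le> p" "p \<le> s" "0 \<le> q" "q \<le> s"
      "f (x + s *\<^sub>R u + s *\<^sub>R v) - f (x + s *\<^sub>R u) - f (x + s *\<^sub>R v) + f x
        = s\<^sup>2 * (hf (x + p *\<^sub>R u + q *\<^sub>R v) v \<bullet> u)"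
      using second_difference_eq[OF fg fh s, of x u v] by blast
    obtain p' q' where pq': "0 \<le> p'" "p' \<le> s" "0 \<le> q'" "q' \<le> s"
      "f (x + s *\<^sub>R v + s *\<^sub>R u) - f (x + s *\<^sub>R v) - f (x + s *\<^sub>R u) + f x
        = s\<^sup>2 * (hf (x + p' *\<^sub>R v + q' *\<^sub>R u) u \<bullet> v)"
      using second_difference_eq[OF fg fh s, of x v u] by blast
    have "s\<^sup>2 * (hf (x + p *\<^sub>R u + q *\<^sub>R v) v \<bullet> u) = s\<^sup>2 * (hf (x + p' *\<^sub>R v + q' *\<^sub>R u) u \<bullet> v)"
      unfolding pq(5)[symmetric] pq'(5)[symmetric] by (simp add: algebra_simps)
    then have "hf (x + p *\<^sub>R u + q *\<^sub>R v) v \<bullet> u = hf (x + p' *\<^sub>R v + q' *\<^sub>R u) u \<bullet> v"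
      using s by simp
    moreover have "\<bar>hf (x + p *\<^sub>R u + q *\<^sub>R v) v \<bullet> u - hf x v \<bullet> u\<bar> < e"
      using near[OF pq(1-4), of u v] by (intro d1(2)) (simp add: N_def)
    moreover have "\<bar>hf (x + p' *\<^sub>R v + q' *\<^sub>R u) u \<bullet> v - hf x u \<bullet> v\<bar> < e"
      using near[OF pq'(1-4), of v u] by (intro d2(2)) (simp add: N_def)
    ultimately show ?thesis by linarith
  qed
  then have "\<bar>hf x u \<bullet> v - hf x v \<bullet> u\<bar> \<le> 0"
    by (metis field_le_epsilon add_0 mult.commute half_gt_zero times_divide_eq_left nonzero_mult_div_cancel_right zero_neq_numeral)
  then show ?thesis by simp
qed

lemma convex_gradient_inequality:
  fixes f :: "'a::real_inner \<Rightarrow> real"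
  assumes conv: "convex_on UNIV f" and fg: "\<And>y. (f has_derivative (\<lambda>h. gf y \<bullet> h)) (at y)"
  shows "f y + gf y \<bullet> (z - y) \<le> f z"
proof -
  have "gf (y + 0 *\<^sub>R (z - y)) \<bullet> (z - y) \<le> f z - f y"
  proof (rule derivative_le_of_increment_le[OF has_real_derivative_along_line[of f gf, OF fg], of 1])
    fix s :: real assume s: "0 < s" "s < 1"
    have "f ((1 - s) *\<^sub>R y + s *\<^sub>R z) \<le> (1 - s) * f y + s * f z"
      using convex_onD[OF conv, of s y z] s by simp
    then show "f (y + s *\<^sub>R (z - y)) - f (y + 0 *\<^sub>R (z - y)) \<le> s * (f z - f y)"
      by (simp add: algebra_simps)
  qed simp
  then show ?thesis by simp
qed

text \<open>The gradient inequalities from \<open>x\<close> to \<open>x + s *\<^sub>R h\<close> and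
  back add up to monotonicity of the gradient along \<open>h\<close>. The sign is reversed in the
  proof because the comparison of derivatives gives upper bounds.\<close>

lemma convex_hessian_nonneg:
  fixes f :: "'a::real_inner \<Rightarrow> real"
  assumes conv: "convex_on UNIV f" and fg: "\<And>y. (f has_derivative (\<lambda>h. gf y \<bullet> h)) (at y)"
    and fh: "\<And>y. (gf has_derivative hf y) (at y)"
  shows "0 \<le> hf x h \<bullet> h"
proof -
  have "- (hf (x + 0 *\<^sub>R h) h \<bullet> h) \<le> 0"
  proof (rule derivative_le_of_increment_le[OF DERIV_minus[OF has_real_derivative_inner_along_line[OF fh]], of 1])
    fix s :: real assume s: "0 < s" "s < 1"
    have "f x + gf x \<bullet> (s *\<^sub>R h) \<le> f (x + s *\<^sub>R h)" "f (x + s *\<^sub>R h) - gf (x + s *\<^sub>R h) \<bullet> (s *\<^sub>R h) \<le> f x"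
      using convex_gradient_inequality[OF conv fg, of x "x + s *\<^sub>R h"]
        convex_gradient_inequality[OF conv fg, of "x + s *\<^sub>R h" x] by auto
    then have "s * (gf x \<bullet> h) \<le> s * (gf (x + s *\<^sub>R h) \<bullet> h)" by simp
    then show "- (gf (x + s *\<^sub>R h) \<bullet> h) - - (gf (x + 0 *\<^sub>R h) \<bullet> h) \<le> s * 0" using s by simp
  qed simp
  then show ?thesis by simp
qed

text \<open>Moving from \<open>y\<close> a fraction \<open>s\<close> towards \<open>z\<close> raises
  \<open>psi\<close> by at most \<open>s * (psi z - psi y)\<close>; minimality then limits the
  first-order decrease of \<open>G\<close>. It serves both the model minimized in a step and, with
  \<open>G\<close> equal to \<open>f\<close> minus a linear form, the subgradients of
  \<open>F\<close>.\<close>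

lemma composite_minimizer_optimality:
  fixes G psi :: "'a::real_inner \<Rightarrow> real"
  assumes Q: "convex Q" and psi: "convex_on Q psi" and y: "y \<in> Q" and z: "z \<in> Q"
    and G: "(G has_derivative (\<lambda>h. g \<bullet> h)) (at y)"
    and min: "\<And>w. w \<in> Q \<Longrightarrow> G y + psi y \<le> G w + psi w"
  shows "psi y \<le> psi z + g \<bullet> (z - y)"
proof -
  have "((\<lambda>s. y + s *\<^sub>R (z - y)) has_derivative (\<lambda>t. t *\<^sub>R (z - y))) (at 0)"
    by (auto intro!: derivative_eq_intros)
  from has_derivative_compose[OF this, of G "\<lambda>h. g \<bullet> h"] G
  have "((\<lambda>s. G (y + s *\<^sub>R (z - y))) has_real_derivative g \<bullet> (z - y)) (at 0)"
    by (simp add: has_field_derivative_def mult_commute_abs)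
  then have der: "((\<lambda>s. - G (y + s *\<^sub>R (z - y))) has_real_derivative - (g \<bullet> (z - y))) (at 0)"
    by (rule DERIV_minus)
  have "- (g \<bullet> (z - y)) \<le> psi z - psi y"
  proof (rule derivative_le_of_increment_le[OF der, of 1])
    fix s :: real assume s: "0 < s" "s < 1"
    have "(1 - s) *\<^sub>R y + s *\<^sub>R z \<in> Q" using convexD_alt[OF Q y z, of s] s by simp
    from min[OF this] convex_onD[OF psi, of s y z] s y z
    show "- G (y + s *\<^sub>R (z - y)) - - G (y + 0 *\<^sub>R (z - y)) \<le> s * (psi z - psi y)"
      by (simp add: algebra_simps)
  qed simp
  then show ?thesis by simp
qed

subsection \<open>Functions with Lipschitz Hessian\<close>

locale lipschitz_hessian =
  fixes nrm :: "'a::euclidean_space \<Rightarrow> real" and Q :: "'a set"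
    and f :: "'a \<Rightarrow> real" and gf :: "'a \<Rightarrow> 'a" and hf :: "'a \<Rightarrow> 'a \<Rightarrow> 'a" and L2 :: real
  assumes nrm: "is_norm nrm"
    and Q: "convex Q"
    and f_grad: "\<And>y. (f has_derivative (\<lambda>h. gf y \<bullet> h)) (at y)"
    and f_hess: "\<And>y. (gf has_derivative hf y) (at y)"
    and hess_cont: "\<And>v. continuous_on UNIV (\<lambda>y. hf y v)"
    and L2: "L2 \<ge> 0"
    and hess_lip: "\<And>y z. y \<in> Q \<Longrightarrow> z \<in> Q \<Longrightarrow>
                     op_norm_sa nrm (\<lambda>v. hf y v - hf z v) \<le> L2 * nrm (y - z)"
begin

lemma hess_sym: "hf x u \<bullet> v = hf x v \<bullet> u"
  by (rule hessian_symmetric[OF f_grad f_hess hess_cont])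

lemma hess_bounded_linear: "bounded_linear (hf y)"
  by (rule has_derivative_bounded_linear[OF f_hess])

lemma hess_diff_quadratic_form:
  assumes "y \<in> Q" "z \<in> Q"
  shows "\<bar>(hf y w - hf z w) \<bullet> w\<bar> \<le> L2 * nrm (y - z) * (nrm w)\<^sup>2"
  using quadratic_form_le_op_norm_sa[OF nrm bounded_linear_sub[OF hess_bounded_linear[of y] hess_bounded_linear[of z]], of w]
    mult_right_mono[OF hess_lip[OF assms], of "(nrm w)\<^sup>2"] by simp

lemma segment_in_Q: "x \<in> Q \<Longrightarrow> y \<in> Q \<Longrightarrow> 0 \<le> t \<Longrightarrow> t \<le> 1 \<Longrightarrow> x + t *\<^sub>R (y - x) \<in> Q"
  using convexD_alt[OF Q, of x y t] by (simp add: algebra_simps)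

text \<open>The polarization bound for the Hessian difference at distance
  \<open>t * nrm (y - x)\<close> contributes a factor \<open>2 * t\<close>, which integrates to 1
  over the segment. The direction \<open>v\<close> is arbitrary, at the price of twice the sharp
  constant.\<close>

lemma gradient_residual_full:
  assumes x: "x \<in> Q" and y: "y \<in> Q"
  shows "(gf y - gf x - hf x (y - x)) \<bullet> v \<le> L2 * (nrm (y - x))\<^sup>2 * nrm v"
proof -
  let ?h = "y - x" let ?K = "L2 * (nrm (y - x))\<^sup>2 * nrm v"
  let ?P = "\<lambda>t. gf (x + t *\<^sub>R ?h) \<bullet> v - t * (hf x ?h \<bullet> v) - t\<^sup>2 * ?K"
  have "?P 1 \<le> ?P 0"
  proof (rule DERIV_nonpos_imp_nonincreasing[where f = ?P])
    fix t :: real assume t: "0 \<le> t" "t \<le> 1"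
    have mem: "x + t *\<^sub>R ?h \<in> Q" using segment_in_Q[OF x y t] .
    have "(hf (x + t *\<^sub>R ?h) ?h - hf x ?h) \<bullet> v \<le> 2 * (L2 * nrm (x + t *\<^sub>R ?h - x)) * nrm ?h * nrm v"
    proof (rule polarization_bound[where B = "\<lambda>w. hf (x + t *\<^sub>R (y - x)) w - hf x w", OF nrm])
      show "linear (\<lambda>w. hf (x + t *\<^sub>R ?h) w - hf x w)"
        by (intro linear_compose_sub bounded_linear.linear hess_bounded_linear)
      show "(hf (x + t *\<^sub>R ?h) a - hf x a) \<bullet> b = (hf (x + t *\<^sub>R ?h) b - hf x b) \<bullet> a" for a b
        using hess_sym[of "x + t *\<^sub>R ?h" a b] hess_sym[of x a b] by (simp only: inner_diff_left)
    qed (rule hess_diff_quadratic_form[OF mem x])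
    also have "\<dots> = 2 * t * ?K" using t by (simp add: is_norm_scaleR[OF nrm] power2_eq_square)
    finally have "(hf (x + t *\<^sub>R ?h) ?h - hf x ?h) \<bullet> v \<le> 2 * t * ?K" .
    moreover have "(?P has_real_derivative
        hf (x + t *\<^sub>R ?h) ?h \<bullet> v - hf x ?h \<bullet> v - 2 * t * ?K) (at t)"
      by (auto intro!: derivative_eq_intros has_real_derivative_inner_along_line f_hess)
    ultimately show "\<exists>D. (?P has_real_derivative D) (at t) \<and> D \<le> 0"
      by (intro exI conjI) (auto simp: inner_diff_left)
  qed simp
  then show ?thesis by (simp add: inner_diff_left)
qed

text \<open>Differentiating the first-order Taylor remainder of f at (x, y) along a common translation of
  both points in direction v bounds the gradient residual by the Lipschitz constant without the
  polarization factor, because the Hessian difference is then only evaluated at y - x twice.\<close>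

lemma gradient_residual_translatable:
  assumes e: "e > 0" and xv: "\<And>s. 0 \<le> s \<Longrightarrow> s < e \<Longrightarrow> x + s *\<^sub>R v \<in> Q"
    and yv: "\<And>s. 0 \<le> s \<Longrightarrow> s < e \<Longrightarrow> y + s *\<^sub>R v \<in> Q"
  shows "(gf y - gf x - hf x (y - x)) \<bullet> v \<le> L2 / 2 * (nrm (y - x))\<^sup>2 * nrm v"
proof -
  let ?h = "y - x" let ?K = "L2 / 2 * (nrm (y - x))\<^sup>2 * nrm v"
  let ?R = "\<lambda>s. f (y + s *\<^sub>R v) - f (x + s *\<^sub>R v) - gf (x + s *\<^sub>R v) \<bullet> ?h"
  have der: "(?R has_real_derivative
      gf (y + 0 *\<^sub>R v) \<bullet> v - gf (x + 0 *\<^sub>R v) \<bullet> v - hf (x + 0 *\<^sub>R v) v \<bullet> ?h) (at 0)"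
    by (intro DERIV_diff has_real_derivative_along_line has_real_derivative_inner_along_line f_grad f_hess)
  have "gf (y + 0 *\<^sub>R v) \<bullet> v - gf (x + 0 *\<^sub>R v) \<bullet> v - hf (x + 0 *\<^sub>R v) v \<bullet> ?h \<le> ?K"
  proof (rule derivative_le_of_increment_le[OF der e])
    fix s :: real assume s: "0 < s" "s < e"
    let ?xs = "x + s *\<^sub>R v"
    have xs: "?xs \<in> Q" "x \<in> Q" and ys: "y + s *\<^sub>R v \<in> Q" "y \<in> Q"
      using xv[of s] yv[of s] xv[of 0] yv[of 0] s e by auto
    \<comment> \<open>The original and the translated segment are \<open>s *\<^sub>R v\<close>
      apart, and \<open>2 * s * ?K\<close> bounds the form of their Hessian difference at
      \<open>?h\<close>. Integrating in \<open>t\<close> twice, through \<open>?P\<close> and then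
      \<open>?G\<close>, halves this to \<open>s * ?K\<close>.\<close>
    let ?P = "\<lambda>t. gf (?xs + t *\<^sub>R ?h) \<bullet> ?h - gf (x + t *\<^sub>R ?h) \<bullet> ?h - t * (2 * s * ?K)"
    have P: "?P t \<le> ?P 0" if t: "0 \<le> t" "t \<le> 1" for t
    proof (rule DERIV_nonpos_imp_nonincreasing[where f = ?P, OF t(1)])
      fix r :: real assume r: "0 \<le> r" "r \<le> t"
      have m: "?xs + r *\<^sub>R ?h \<in> Q" "x + r *\<^sub>R ?h \<in> Q"
        using segment_in_Q[OF xs(1) ys(1), of r] segment_in_Q[OF xs(2) ys(2), of r] r t by auto
      have "(hf (?xs + r *\<^sub>R ?h) ?h - hf (x + r *\<^sub>R ?h) ?h) \<bullet> ?h \<le> L2 * nrm (s *\<^sub>R v) * (nrm ?h)\<^sup>2"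
        using hess_diff_quadratic_form[OF m, of ?h] by (simp add: abs_le_iff)
      also have "\<dots> = 2 * s * ?K" using s by (simp add: is_norm_scaleR[OF nrm])
      finally have "hf (?xs + r *\<^sub>R ?h) ?h \<bullet> ?h - hf (x + r *\<^sub>R ?h) ?h \<bullet> ?h - 2 * s * ?K \<le> 0"
        by (simp only: inner_diff_left)
      moreover have "(?P has_real_derivative
          hf (?xs + r *\<^sub>R ?h) ?h \<bullet> ?h - hf (x + r *\<^sub>R ?h) ?h \<bullet> ?h - 1 * (2 * s * ?K)) (at r)"
        by (intro DERIV_diff DERIV_cmult_right DERIV_ident has_real_derivative_inner_along_line f_hess)
      ultimately show "\<exists>D. (?P has_real_derivative D) (at r) \<and> D \<le> 0"
        by (intro exI conjI) auto
    qed
    let ?G = "\<lambda>t. f (?xs + t *\<^sub>R ?h) - f (x + t *\<^sub>R ?h) - t * (gf ?xs \<bullet> ?h - gf x \<bullet> ?h) - t\<^sup>2 * (s * ?K)"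
    have "?G 1 \<le> ?G 0"
    proof (rule DERIV_nonpos_imp_nonincreasing[where f = ?G])
      fix t :: real assume t: "0 \<le> t" "t \<le> 1"
      have "(?G has_real_derivative gf (?xs + t *\<^sub>R ?h) \<bullet> ?h - gf (x + t *\<^sub>R ?h) \<bullet> ?h
          - 1 * (gf ?xs \<bullet> ?h - gf x \<bullet> ?h) - 2 * t * (s * ?K)) (at t)"
        by (intro DERIV_diff DERIV_cmult_right DERIV_ident has_real_derivative_along_line f_grad)
           (auto intro!: derivative_eq_intros)
      moreover have "gf (?xs + t *\<^sub>R ?h) \<bullet> ?h - gf (x + t *\<^sub>R ?h) \<bullet> ?h
          - 1 * (gf ?xs \<bullet> ?h - gf x \<bullet> ?h) - 2 * t * (s * ?K) \<le> 0"
        using P[OF t] by (simp add: algebra_simps)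
      ultimately show "\<exists>D. (?G has_real_derivative D) (at t) \<and> D \<le> 0" by blast
    qed simp
    then show "?R s - ?R 0 \<le> s * ?K" by (simp add: algebra_simps)
  qed
  \<comment> \<open>Differentiating the translated gradient produces
    \<open>hf x v \<bullet> ?h\<close>; symmetry turns it into the Hessian term of the
    residual.\<close>
  then show ?thesis using hess_sym[of x v ?h] by (simp add: inner_diff_left)
qed

text \<open>At the relative boundary of \<open>Q\<close> a translation along \<open>b - a\<close>
  may leave \<open>Q\<close>. Both points are therefore contracted towards a relative interior point
  \<open>q\<close>, where short translations stay inside, and the contraction is undone by
  continuity.\<close>

lemma gradient_residual_feasible:
  assumes x: "x \<in> Q" and y: "y \<in> Q" and a: "a \<in> Q" and b: "b \<in> Q"
  shows "(gf y - gf x - hf x (y - x)) \<bullet> (b - a) \<le> L2 / 2 * (nrm (y - x))\<^sup>2 * nrm (b - a)"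
proof -
  have "rel_interior Q \<noteq> {}" using rel_interior_eq_empty[OF Q] x by auto
  then obtain q where q: "q \<in> rel_interior Q" by auto
  let ?v = "b - a"
  define p where "p = (\<lambda>e w. w - e *\<^sub>R (w - q))"
  \<comment> \<open>The vector \<open>b - a\<close> is parallel to the affine hull of
    \<open>Q\<close>, and a relative interior point has a ball whose part in that hull lies in
    \<open>Q\<close>.\<close>
  have translatable: "\<exists>d>0. \<forall>s. 0 \<le> s \<and> s < d \<longrightarrow> w + s *\<^sub>R ?v \<in> Q" if w: "w \<in> rel_interior Q" for w
  proof -
    obtain d where d: "d > 0" "ball w d \<inter> affine hull Q \<subseteq> Q" "w \<in> Q"
      using w unfolding mem_rel_interior_ball by blast
    have N: "norm ?v + 1 > 0" by (simp add: add_nonneg_pos)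
    have "w + s *\<^sub>R ?v \<in> Q" if s: "0 \<le> s" "s < d / (norm ?v + 1)" for s
    proof -
      have "s * norm ?v \<le> s * (norm ?v + 1)" using s by (simp add: mult_left_mono)
      also have "\<dots> < d" using s N by (simp add: field_simps)
      finally have "w + s *\<^sub>R ?v \<in> ball w d" using s by (simp add: dist_norm)
      moreover have "w + s *\<^sub>R ?v \<in> affine hull Q"
        by (intro mem_affine_3_minus[OF affine_affine_hull] hull_inc d(3) a b)
      ultimately show ?thesis using d(2) by blast
    qed
    then show ?thesis using d(1) N by (intro exI[of _ "d / (norm ?v + 1)"]) auto
  qed
  have pint: "p e w \<in> rel_interior Q" if "0 < e" "e \<le> 1" "w \<in> Q" for e w
    unfolding p_def using rel_interior_convex_shrink[OF Q q that(3,1,2)] .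
  have diff: "p e y - p e x = (1 - e) *\<^sub>R (y - x)" for e by (simp add: p_def algebra_simps)
  have le: "(gf (p e y) - gf (p e x)) \<bullet> ?v - (1 - e) * (hf (p e x) (y - x) \<bullet> ?v)
      \<le> L2 / 2 * ((1 - e) * nrm (y - x))\<^sup>2 * nrm ?v" if e: "0 < e" "e < 1" for e
  proof -
    obtain d1 where d1: "d1 > 0" "\<And>s. 0 \<le> s \<Longrightarrow> s < d1 \<Longrightarrow> p e x + s *\<^sub>R ?v \<in> Q"
      using translatable[OF pint[of e x]] x e by auto
    obtain d2 where d2: "d2 > 0" "\<And>s. 0 \<le> s \<Longrightarrow> s < d2 \<Longrightarrow> p e y + s *\<^sub>R ?v \<in> Q"
      using translatable[OF pint[of e y]] y e by auto
    have "(gf (p e y) - gf (p e x) - hf (p e x) (p e y - p e x)) \<bullet> ?v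
        \<le> L2 / 2 * (nrm (p e y - p e x))\<^sup>2 * nrm ?v"
      by (rule gradient_residual_translatable[of "min d1 d2"]) (use d1 d2 in auto)
    then show ?thesis unfolding diff using e
      by (simp add: is_norm_scaleR[OF nrm] linear_simps(5)[OF hess_bounded_linear] inner_diff_left)
  qed
  have plim: "((\<lambda>e. p e w) \<longlongrightarrow> w) (at_right 0)" for w
    unfolding p_def by (auto intro!: tendsto_eq_intros)
  have glim: "((\<lambda>e. gf (p e w)) \<longlongrightarrow> gf w) (at_right 0)" for w
    using isCont_tendsto_compose[OF has_derivative_continuous[OF f_hess] plim] .
  have "isCont (\<lambda>z. hf z (y - x)) x" using hess_cont by (simp add: continuous_on_eq_continuous_at)
  from isCont_tendsto_compose[OF this plim]
  have hlim: "((\<lambda>e. hf (p e x) (y - x)) \<longlongrightarrow> hf x (y - x)) (at_right 0)" .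
  have "(gf y - gf x) \<bullet> ?v - (1 - 0) * (hf x (y - x) \<bullet> ?v) \<le> L2 / 2 * ((1 - 0) * nrm (y - x))\<^sup>2 * nrm ?v"
  proof (rule tendsto_le)
    show "((\<lambda>e. L2 / 2 * ((1 - e) * nrm (y - x))\<^sup>2 * nrm ?v) \<longlongrightarrow> L2 / 2 * ((1 - 0) * nrm (y - x))\<^sup>2 * nrm ?v) (at_right 0)"
      by (intro tendsto_intros)
    show "((\<lambda>e. (gf (p e y) - gf (p e x)) \<bullet> ?v - (1 - e) * (hf (p e x) (y - x) \<bullet> ?v))
        \<longlongrightarrow> (gf y - gf x) \<bullet> ?v - (1 - 0) * (hf x (y - x) \<bullet> ?v)) (at_right 0)"
      by (intro tendsto_intros glim hlim)
    show "\<forall>\<^sub>F e in at_right 0. (gf (p e y) - gf (p e x)) \<bullet> ?v - (1 - e) * (hf (p e x) (y - x) \<bullet> ?v)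
        \<le> L2 / 2 * ((1 - e) * nrm (y - x))\<^sup>2 * nrm ?v"
      using eventually_at_right_real[OF zero_less_one] by eventually_elim (use le in auto)
  qed simp
  then show ?thesis by (simp add: inner_diff_left)
qed

text \<open>The gradient residual is integrated along the segment in the direction
  \<open>y - x\<close>. This is a difference of points of \<open>Q\<close>, so the sharp residual
  bound applies and the constant is \<open>L2 / 6\<close>.\<close>

lemma cubic_upper_bound:
  assumes x: "x \<in> Q" and y: "y \<in> Q"
  shows "f y \<le> f x + gf x \<bullet> (y - x) + 1/2 * (hf x (y - x) \<bullet> (y - x)) + L2 / 6 * (nrm (y - x)) ^ 3"
proof -
  let ?h = "y - x" let ?r = "nrm (y - x)"
  let ?P = "\<lambda>t. f (x + t *\<^sub>R ?h) - t * (gf x \<bullet> ?h) - t\<^sup>2 * (1/2 * (hf x ?h \<bullet> ?h)) - t ^ 3 * (L2 / 6 * ?r ^ 3)"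
  have "?P 1 \<le> ?P 0"
  proof (rule DERIV_nonpos_imp_nonincreasing[where f = ?P])
    fix t :: real assume t: "0 \<le> t" "t \<le> 1"
    have "(?P has_real_derivative gf (x + t *\<^sub>R ?h) \<bullet> ?h - 1 * (gf x \<bullet> ?h)
        - 2 * t * (1/2 * (hf x ?h \<bullet> ?h)) - 3 * t\<^sup>2 * (L2 / 6 * ?r ^ 3)) (at t)"
      by (intro DERIV_diff DERIV_cmult_right DERIV_ident has_real_derivative_along_line f_grad)
         (auto intro!: derivative_eq_intros simp: power2_eq_square)
    moreover have "(gf (x + t *\<^sub>R ?h) - gf x - hf x (x + t *\<^sub>R ?h - x)) \<bullet> ?h
        \<le> L2 / 2 * (nrm (x + t *\<^sub>R ?h - x))\<^sup>2 * ?r"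
      by (rule gradient_residual_feasible[OF x segment_in_Q[OF x y t] x y])
    then have "gf (x + t *\<^sub>R ?h) \<bullet> ?h - 1 * (gf x \<bullet> ?h)
        - 2 * t * (1/2 * (hf x ?h \<bullet> ?h)) - 3 * t\<^sup>2 * (L2 / 6 * ?r ^ 3) \<le> 0"
      by (simp add: is_norm_scaleR[OF nrm] linear_simps(5)[OF hess_bounded_linear] inner_diff_left
          power_mult_distrib power2_eq_square power3_eq_cube t mult_ac)
    ultimately show "\<exists>D. (?P has_real_derivative D) (at t) \<and> D \<le> 0" by blast
  qed simp
  then show ?thesis by simp
qed

end

subsection \<open>Scalar estimates\<close>

text \<open>The left side is maximal over nonnegative \<open>R\<close> at
  \<open>a = sqrt (m / s)\<close>, because its gap to the maximum is a multiple of
  \<open>(R - a)\<^sup>2 * (R + 2 * a)\<close>. It turns uniform convexity into a bound of the gap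
  by the power 3/2 of \<open>m\<close>.\<close>

lemma cubic_young:
  fixes m R s :: real
  assumes "m \<ge> 0" "R \<ge> 0" "s > 0"
  shows "m * R - s / 3 * R ^ 3 \<le> 2 / (3 * sqrt s) * (m * sqrt m)"
proof -
  define a where "a = sqrt m / sqrt s"
  have a: "a \<ge> 0" and s: "sqrt s > 0" using assms by (simp_all add: a_def)
  have m: "m = s * a\<^sup>2" using assms by (simp add: a_def power_divide)
  have "0 \<le> (R - a)\<^sup>2 * (R + 2 * a)" using assms(2) a by simp
  then have "3 * a\<^sup>2 * R - R ^ 3 \<le> 2 * a ^ 3"
    by (simp add: power2_eq_square power3_eq_cube algebra_simps)
  then have "s / 3 * (3 * a\<^sup>2 * R - R ^ 3) \<le> s / 3 * (2 * a ^ 3)"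
    using assms(3) by (intro mult_left_mono) auto
  moreover have "2 / (3 * sqrt s) * (m * sqrt m) = s / 3 * (2 * a ^ 3)"
  proof -
    have "sqrt m = sqrt s * a" using s by (simp add: a_def)
    then show ?thesis using s m by (simp add: power2_eq_square power3_eq_cube)
  qed
  moreover have "m * R - s / 3 * R ^ 3 = s / 3 * (3 * a\<^sup>2 * R - R ^ 3)" by (simp add: m algebra_simps)
  ultimately show ?thesis by linarith
qed

text \<open>Bernoulli's inequality for exponents in [0, 1], obtained from convexity of
  \<open>exp\<close> between 0 and \<open>ln (1 + S)\<close>.\<close>

lemma scaled_ln_le:
  fixes S t :: real
  assumes "0 \<le> t" "t \<le> 1" "0 \<le> S"
  shows "t * ln (1 + S) \<le> ln (1 + S * t)"
proof -
  have "exp ((1 - t) *\<^sub>R 0 + t *\<^sub>R ln (1 + S)) \<le> (1 - t) * exp 0 + t * exp (ln (1 + S))"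
    using convex_onD[OF exp_convex, of t 0 "ln (1 + S)"] assms by simp
  then have "exp (t * ln (1 + S)) \<le> 1 + S * t" using assms by (simp add: algebra_simps)
  then show ?thesis using assms by (subst ln_ge_iff) (auto intro: add_pos_nonneg)
qed

text \<open>In the application \<open>u\<close> is the ratio \<open>m / g\<close>, which may drop to
  1/2, but then \<open>t \<le> u\<close> keeps the step short. With \<open>w\<close> the root of
  \<open>u\<close> truncated at 1, the claim reduces to \<open>(2 - w\<^sup>2) * w \<ge> 1\<close>,
  that is \<open>(1 - w) * (w\<^sup>2 + w - 1) \<ge> 0\<close>, and
  \<open>w \<ge> w\<^sup>2 \<ge> 1/2\<close> makes the second factor nonnegative.\<close>

lemma damping_inequality:
  fixes l t u :: real
  assumes l: "0 \<le> l" "l \<le> 1" and t: "0 \<le> t" "t \<le> 1" and u: "t \<le> u" "1/2 \<le> u"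
  shows "1 \<le> 2 * (1 - l * t / 2) * sqrt u"
proof -
  define w where "w = sqrt (min u 1)"
  have w2: "w\<^sup>2 = min u 1" using u by (simp add: w_def)
  have w: "0 \<le> w" "w \<le> 1" "t \<le> w\<^sup>2" "1/2 \<le> w\<^sup>2" "w \<le> sqrt u"
    using u t by (auto simp: w2) (auto simp: w_def min_def)
  have "l * t \<le> 1 * t" using l t by (intro mult_right_mono) auto
  then have lt: "l * t \<le> w\<^sup>2" using w(3) by linarith
  have ww: "w\<^sup>2 \<le> w" using w(1,2) by (simp add: power2_eq_square mult_left_le)
  have "0 \<le> (1 - w) * (w\<^sup>2 + w - 1)" using w ww by (intro mult_nonneg_nonneg) linarith+
  then have "1 \<le> (2 - w\<^sup>2) * w" by (simp add: power2_eq_square algebra_simps)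
  also have "\<dots> \<le> (2 - l * t) * sqrt u"
    using lt w ww by (intro mult_mono) linarith+
  finally show ?thesis by (simp add: algebra_simps)
qed

text \<open>Only g \<le> 2 m is available between the dual norm g and the bound m on feasible directions.
  The loss is absorbed by the slack of the decrease estimate for short steps.\<close>

lemma log_decrease:
  fixes \<sigma> L2 H \<sigma>3 g m r F F' :: real
  defines "a \<equiv> sqrt (H / 3 * g)"
  defines "m' \<equiv> L2 / 2 * r\<^sup>2 + 1 / \<sigma> * a * r"
  defines "c \<equiv> 1 / \<sigma> + 3 * L2 / (2 * H)"
  defines "S \<equiv> 3 * sqrt 3 / (4 * c powr (3/2)) * sqrt (\<sigma>3 / H)"
  assumes sg: "0 < \<sigma>" and L2: "0 \<le> L2" "L2 \<le> H" and H: "0 < H" and s3: "0 < \<sigma>3"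
    and g: "0 < g" and r: "0 < r" and zm: "a * r \<le> m" and zg: "a * r \<le> g" and gm: "g \<le> 2 * m"
    and F': "0 < F'" and drop: "F' \<le> F - a * r\<^sup>2 + L2 / 6 * r ^ 3"
    and uc: "F' \<le> 2 / (3 * sqrt \<sigma>3) * (m' * sqrt m')"
  shows "ln (1 + S) / sqrt c * (1 + 1/2 * ln (m' / m)) \<le> ln F - ln F'"
proof -
  \<comment> \<open>Normalization of the step: \<open>t\<close> is its length relative to the
    largest one allowed by \<open>zg\<close>, \<open>b\<close> is the ratio of \<open>m'\<close> to
    \<open>a * r\<close>, and \<open>w\<close> is the fraction of \<open>a * r\<^sup>2\<close> left
    after the cubic error. The identity \<open>lt\<close> rewrites all \<open>L2\<close> terms
    through \<open>l * t\<close>.\<close>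
  define l where "l = L2 / H"
  define t where "t = a * r / g"
  define b where "b = 1 / \<sigma> + 3/2 * (l * t)"
  define w where "w = 1 - l * t / 2"
  have a: "a > 0" using H g by (simp add: a_def)
  have a2: "a * a = H * g / 3" using H g by (simp add: a_def)
  have l: "0 \<le> l" "l \<le> 1" using L2 H by (auto simp: l_def)
  have t: "0 \<le> t" "t \<le> 1" using a r g zg by (auto simp: t_def)
  have lt: "l * t * a = L2 * r / 3"
  proof -
    have "l * t * a = L2 / H * r / g * (a * a)" by (simp add: l_def t_def)
    then show ?thesis using H g by (simp add: a2)
  qed
  have m: "m > 0" using gm g by linarith
  have "a * r / g \<le> m / g" using zm g by (simp add: divide_right_mono)
  moreover have "1 / 2 \<le> m / g" using gm g by (simp add: field_simps)
  ultimately have key: "1 \<le> 2 * w * sqrt (m / g)"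
    unfolding w_def using l t by (intro damping_inequality) (auto simp: t_def)
  have m': "m' = b * (a * r)"
  proof -
    have "b * (a * r) = 1 / \<sigma> * a * r + 3/2 * (l * t * a) * r" by (simp add: b_def algebra_simps)
    then show ?thesis unfolding lt by (simp add: m'_def power2_eq_square)
  qed
  have drop': "a * r\<^sup>2 * w \<le> F - F'"
  proof -
    have "a * r\<^sup>2 * w = a * r\<^sup>2 - (l * t * a) * r\<^sup>2 / 2" by (simp add: w_def algebra_simps)
    then show ?thesis unfolding lt using drop by (simp add: power2_eq_square power3_eq_cube)
  qed
  have b: "b > 0" using sg l t by (simp add: b_def add_pos_nonneg)
  have "l * t \<le> l * 1" using l t by (intro mult_left_mono)
  then have bc: "b \<le> c" by (simp add: b_def c_def l_def)
  have c: "c > 0" using b bc by linarith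
  have m'pos: "m' > 0" using m' b a r by simp
  have cm: "m' \<le> c * m" unfolding m' using bc zm b a r c by (intro mult_mono) auto
  have w: "w > 0" using mult_mono[OF l(2) t(2)] l t by (simp add: w_def)
  have S: "S > 0" using c s3 H by (simp add: S_def)
  have c32: "c powr (3/2) = c * sqrt c"
    using c powr_add[of c 1 "1/2"] by (simp add: powr_half_sqrt)
  have Sc: "S / sqrt c = 3 * sqrt 3 * sqrt \<sigma>3 / (4 * c\<^sup>2 * sqrt H)"
    using c by (simp add: S_def c32 real_sqrt_divide power2_eq_square)
  define q where "q = sqrt (m' / m)"
  have q: "q > 0" using m'pos m by (simp add: q_def)
  \<comment> \<open>The guaranteed decrease is divided by the upper bound \<open>uc\<close> for the
    new gap. The constant in \<open>S\<close> is the one for which all numerical factors cancel;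
    \<open>key\<close> pays for replacing \<open>g\<close> by \<open>m\<close>.\<close>
  have ratio: "S / sqrt c * q \<le> (F - F') / F'"
  proof -
    have "b\<^sup>2 \<le> c\<^sup>2" using bc b by (simp add: power_mono)
    also have "\<dots> \<le> c\<^sup>2 * (2 * w * sqrt (m / g))" using key c by simp
    finally have "b\<^sup>2 * sqrt g \<le> 2 * c\<^sup>2 * w * sqrt m"
      using g by (simp add: real_sqrt_divide field_simps)
    then have "b\<^sup>2 * sqrt g * (a * r)\<^sup>2 \<le> 2 * c\<^sup>2 * w * sqrt m * (a * r)\<^sup>2"
      by (rule mult_right_mono) simp
    then have 1: "m'\<^sup>2 * sqrt g \<le> 2 * c\<^sup>2 * w * sqrt m * (a * r)\<^sup>2"
      by (simp add: m' power_mult_distrib mult_ac)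
    have sa: "sqrt 3 * a = sqrt H * sqrt g" by (simp add: a_def real_sqrt_mult real_sqrt_divide)
    have "S / sqrt c * q * (2 / (3 * sqrt \<sigma>3) * (m' * sqrt m')) = sqrt 3 * m'\<^sup>2 / (2 * c\<^sup>2 * sqrt H * sqrt m)"
    proof -
      have "q * (m' * sqrt m') = m' * (sqrt m' * sqrt m') / sqrt m"
        by (simp only: q_def real_sqrt_divide times_divide_eq_left times_divide_eq_right mult_ac)
      also have "sqrt m' * sqrt m' = m'" using m'pos by simp
      finally have qm: "q * (m' * sqrt m') = m'\<^sup>2 / sqrt m" by (simp only: power2_eq_square)
      have "S / sqrt c * q * (2 / (3 * sqrt \<sigma>3) * (m' * sqrt m'))
          = (S / sqrt c * (2 / (3 * sqrt \<sigma>3))) * (q * (m' * sqrt m'))" by (simp only: mult_ac)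
      then show ?thesis unfolding qm Sc using s3 by simp
    qed
    also have "\<dots> \<le> a * r\<^sup>2 * w"
    proof -
      have "a * (sqrt 3 * m'\<^sup>2) = sqrt H * (m'\<^sup>2 * sqrt g)" using sa by (simp add: mult_ac)
      also have "\<dots> \<le> sqrt H * (2 * c\<^sup>2 * w * sqrt m * (a * r)\<^sup>2)" using 1 H by (intro mult_left_mono) auto
      also have "\<dots> = a * (a * r\<^sup>2 * w * (2 * c\<^sup>2 * sqrt H * sqrt m))" by (simp add: power2_eq_square mult_ac)
      finally have "sqrt 3 * m'\<^sup>2 \<le> a * r\<^sup>2 * w * (2 * c\<^sup>2 * sqrt H * sqrt m)" using a by simp
      then show ?thesis using c H m by (simp add: pos_divide_le_eq)
    qed
    also note drop'
    finally have "S / sqrt c * q * (2 / (3 * sqrt \<sigma>3) * (m' * sqrt m')) \<le> F - F'" .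
    moreover have "S / sqrt c * q * F' \<le> S / sqrt c * q * (2 / (3 * sqrt \<sigma>3) * (m' * sqrt m'))"
      using uc S c q by (intro mult_left_mono) auto
    ultimately show ?thesis using F' by (simp add: pos_le_divide_eq)
  qed
  \<comment> \<open>Since \<open>m' \<le> c * m\<close>, the number \<open>q / sqrt c\<close> is an
    admissible exponent in Bernoulli's inequality.\<close>
  have th: "q / sqrt c \<le> 1"
  proof -
    have "q \<le> sqrt c" unfolding q_def using cm m by (simp add: pos_divide_le_eq)
    then show ?thesis using c by simp
  qed
  \<comment> \<open>Replacing \<open>q\<close> by its lower bound \<open>1 + ln q\<close> makes the
    estimate additive in \<open>ln m\<close>, so that it telescopes over the iterations.\<close>
  have "ln q \<le> q - 1" using q by (rule ln_le_minus_one)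
  then have "1 + 1/2 * ln (m' / m) \<le> q" using m m'pos by (simp add: q_def ln_sqrt)
  then have "ln (1 + S) / sqrt c * (1 + 1/2 * ln (m' / m)) \<le> ln (1 + S) / sqrt c * q"
    using S c by (intro mult_left_mono) auto
  also have "\<dots> = q / sqrt c * ln (1 + S)" by simp
  also have "\<dots> \<le> ln (1 + S * (q / sqrt c))" using th q c S by (intro scaled_ln_le) auto
  also have "\<dots> \<le> ln (1 + (F - F') / F')"
  proof -
    have "0 < S * (q / sqrt c)" using S q c by simp
    then show ?thesis using ratio by (subst ln_le_cancel_iff) (auto simp: mult_ac)
  qed
  also have "1 + (F - F') / F' = F / F'" using F' by (simp add: field_simps)
  also have "ln (F / F') = ln F - ln F'"
  proof -
    have "0 < S / sqrt c * q" using S q c by simp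
    then have "0 < (F - F') / F'" using ratio by linarith
    then have "F > 0" using F' by (simp add: zero_less_divide_iff)
    then show ?thesis using F' by (simp add: ln_div)
  qed
  finally show ?thesis .
qed

text \<open>With \<open>X = ln B - ln Fk\<close> the hypothesis reads
  \<open>L / s * (k - X / 2) \<le> X\<close>; solving this for \<open>X\<close> produces the
  denominator \<open>s + L / 2\<close>.\<close>

lemma exp_rate_of_log_potential:
  fixes Fk B L s :: real
  assumes Fk: "0 < Fk" and B: "0 < B" and L: "0 \<le> L" and s: "0 < s"
    and le: "L / s * (real k + 1/2 * (ln Fk - ln B)) \<le> ln B - ln Fk"
  shows "Fk \<le> B * exp (- (real k * L) / (s + 1/2 * L))"
proof -
  have "L * (real k + 1/2 * (ln Fk - ln B)) \<le> s * (ln B - ln Fk)"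
    using le s by (simp add: field_simps)
  then have "real k * L \<le> (ln B - ln Fk) * (s + 1/2 * L)"
    by (simp add: algebra_simps diff_divide_distrib)
  then have "real k * L / (s + 1/2 * L) \<le> ln B - ln Fk"
    using s L by (subst pos_divide_le_eq) auto
  then have "ln Fk \<le> ln B + - (real k * L) / (s + 1/2 * L)" by simp
  then have "exp (ln Fk) \<le> exp (ln B + - (real k * L) / (s + 1/2 * L))" by simp
  then show ?thesis using Fk B by (simp only: exp_add exp_ln)
qed

subsection \<open>The regularized Newton step\<close>

locale bregman_newton = lipschitz_hessian nrm Q f gf hf L2
  for nrm :: "'a::euclidean_space \<Rightarrow> real" and Q f gf hf L2 +
  fixes psi d :: "'a \<Rightarrow> real" and gd :: "'a \<Rightarrow> 'a" and \<sigma> :: real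
  assumes psi_convex: "convex_on Q psi"
    and f_convex: "convex_on UNIV f"
    and sigma: "0 < \<sigma>"
    and d_grad: "\<And>y. (d has_derivative (\<lambda>h. gd y \<bullet> h)) (at y)"
    and d_strong: "\<And>y z. y \<in> Q \<Longrightarrow> z \<in> Q \<Longrightarrow>
                     d z \<ge> d y + gd y \<bullet> (z - y) + \<sigma> / 2 * (nrm (z - y))\<^sup>2"
    and d_lip: "\<And>y z. y \<in> Q \<Longrightarrow> z \<in> Q \<Longrightarrow> dual_norm nrm (gd y - gd z) \<le> nrm (y - z)"
begin

abbreviation F :: "'a \<Rightarrow> real" where "F \<equiv> \<lambda>u. f u + psi u"

lemma gd_strongly_monotone:
  assumes "x \<in> Q" "y \<in> Q"
  shows "\<sigma> * (nrm (y - x))\<^sup>2 \<le> (gd y - gd x) \<bullet> (y - x)"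
  using d_strong[OF assms] d_strong[OF assms(2,1)]
  by (simp add: is_norm_minus_commute[OF nrm, of x y] inner_diff field_simps)

lemma gd_diff_inner_le:
  assumes "x \<in> Q" "y \<in> Q"
  shows "(gd x - gd y) \<bullet> v \<le> nrm (y - x) * nrm v"
  using inner_le_dual_norm[OF nrm, of "gd x - gd y" v]
    mult_right_mono[OF d_lip[OF assms] is_norm_nonneg[OF nrm, of v]]
  by (simp add: is_norm_minus_commute[OF nrm, of x y])

text \<open>A sum rule: \<open>x\<close> minimizes \<open>F\<close> minus the linear form of
  \<open>g\<close> over \<open>Q\<close>, and first-order optimality for the smooth part
  \<open>f\<close> minus that form leaves \<open>g - gf x\<close> as a subgradient of
  \<open>psi\<close>.\<close>

lemma psi_subgradient:
  assumes x: "x \<in> Q" and g: "g \<in> subdiff Q F x" and y: "y \<in> Q"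
  shows "psi x + (g - gf x) \<bullet> (y - x) \<le> psi y"
proof -
  have "psi x \<le> psi y + (gf x - g) \<bullet> (y - x)"
  proof (rule composite_minimizer_optimality[OF Q psi_convex x y])
    show "((\<lambda>u. f u - g \<bullet> u) has_derivative (\<lambda>h. (gf x - g) \<bullet> h)) (at x)"
      by (auto intro!: derivative_eq_intros f_grad simp: inner_diff_left)
    show "f x - g \<bullet> x + psi x \<le> f w - g \<bullet> w + psi w" if "w \<in> Q" for w
      using g that by (auto simp: subdiff_def inner_diff_right algebra_simps)
  qed
  then show ?thesis by (simp add: inner_diff_left)
qed

lemma model_smooth_part_has_derivative:
  "((\<lambda>z. f x + gf x \<bullet> (z - x) + 1/2 * (hf x (z - x) \<bullet> (z - x)) + A * bregman d gd x z)
    has_derivative (\<lambda>h. (gf x + hf x (y - x) + A *\<^sub>R (gd y - gd x)) \<bullet> h)) (at y)"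
proof -
  have id: "((\<lambda>z. z - x) has_derivative (\<lambda>h. h)) (at y)" by (auto intro!: derivative_eq_intros)
  have h: "((\<lambda>z. hf x (z - x)) has_derivative (\<lambda>h. hf x h)) (at y)"
    using bounded_linear.has_derivative[OF hess_bounded_linear id] .
  have "((\<lambda>z. 1/2 * (hf x (z - x) \<bullet> (z - x))) has_derivative
      (\<lambda>h. 1/2 * (hf x (y - x) \<bullet> h + hf x h \<bullet> (y - x)))) (at y)"
    by (intro has_derivative_mult_right has_derivative_inner h id)
  then have quad: "((\<lambda>z. 1/2 * (hf x (z - x) \<bullet> (z - x))) has_derivative (\<lambda>h. hf x (y - x) \<bullet> h)) (at y)"
    by (simp add: hess_sym[of x _ "y - x"])
  show ?thesis unfolding bregman_def
    by (rule derivative_eq_intros quad d_grad refl)+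
       (auto simp: fun_eq_iff inner_add_left inner_diff_left algebra_simps)
qed

context
  fixes A :: real and x y g g' :: 'a and r :: real
  defines "r \<equiv> nrm (y - x)"
    and "g' \<equiv> gf y - gf x - hf x (y - x) - A *\<^sub>R (gd y - gd x)"
  assumes A: "A > 0" and x: "x \<in> Q" and g: "g \<in> subdiff Q F x"
    and T: "is_T Q f gf hf d gd psi A x y"
begin

lemma newton_step_in_Q: "y \<in> Q"
  using T by (simp add: is_T_def)

lemma newton_step_optimality:
  assumes z: "z \<in> Q"
  shows "psi y \<le> psi z + (gf x + hf x (y - x) + A *\<^sub>R (gd y - gd x)) \<bullet> (z - y)"
  by (rule composite_minimizer_optimality[OF Q psi_convex newton_step_in_Q z
        model_smooth_part_has_derivative])
     (use T in \<open>simp add: is_T_def model_def\<close>)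

text \<open>The vector \<open>g'\<close> is \<open>gf y\<close> minus the gradient at
  \<open>y\<close> of the smooth part of the model. By optimality the negative of the latter is a
  subgradient of \<open>psi\<close> at \<open>y\<close>, and convexity of \<open>f\<close>
  contributes \<open>gf y\<close>.\<close>

lemma newton_step_subgradient: "g' \<in> subdiff Q F y"
proof -
  have "F y + g' \<bullet> (z - y) \<le> F z" if z: "z \<in> Q" for z
    using newton_step_optimality[OF z] convex_gradient_inequality[OF f_convex f_grad, of y z]
    by (simp add: g'_def inner_diff_left inner_add_left)
  then show ?thesis by (simp add: subdiff_def)
qed

text \<open>Optimality is tested at the old point \<open>x\<close>; strong monotonicity of
  \<open>gd\<close> bounds the Bregman term from below.\<close>

lemma newton_step_psi_decrease:
  "psi y + gf x \<bullet> (y - x) + hf x (y - x) \<bullet> (y - x) + A * \<sigma> * r\<^sup>2 \<le> psi x"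
proof -
  have "A * (\<sigma> * r\<^sup>2) \<le> A * ((gd y - gd x) \<bullet> (y - x))"
    unfolding r_def using gd_strongly_monotone[OF x newton_step_in_Q] A by simp
  moreover have "psi y \<le> psi x - (gf x + hf x (y - x) + A *\<^sub>R (gd y - gd x)) \<bullet> (y - x)"
    using newton_step_optimality[OF x] by (metis add_uminus_conv_diff inner_minus_right minus_diff_eq)
  ultimately show ?thesis by (simp add: inner_add_left)
qed

text \<open>Adding the subgradient inequality of \<open>psi\<close> at \<open>x\<close> cancels the
  \<open>psi\<close> and \<open>gf x\<close> terms, and the nonnegative Hessian term is dropped. The
  pairing is kept with \<open>x - y\<close>, a difference of points of \<open>Q\<close>, so the
  sharper bound on the subgradient can be used later.\<close>

lemma newton_step_length: "A * \<sigma> * r\<^sup>2 \<le> g \<bullet> (x - y)"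
  using newton_step_psi_decrease psi_subgradient[OF x g newton_step_in_Q]
    convex_hessian_nonneg[OF f_convex f_grad f_hess, of x "y - x"]
  by (simp add: inner_diff)

text \<open>The full Hessian term in the decrease of \<open>psi\<close> outweighs the half in the
  cubic bound for \<open>f\<close>; the remaining half is nonnegative.\<close>

lemma newton_step_decrease: "F y \<le> F x - A * \<sigma> * r\<^sup>2 + L2 / 6 * r ^ 3"
  using newton_step_psi_decrease cubic_upper_bound[OF x newton_step_in_Q]
    convex_hessian_nonneg[OF f_convex f_grad f_hess, of x "y - x"]
  unfolding r_def by linarith

lemma bregman_part_inner_le: "A * ((gd x - gd y) \<bullet> v) \<le> A * r * nrm v"
  using mult_left_mono[OF gd_diff_inner_le[OF x newton_step_in_Q, of v], of A] A
  by (simp add: r_def)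

lemma newton_step_gradient_feasible:
  assumes "a \<in> Q" "b \<in> Q"
  shows "g' \<bullet> (b - a) \<le> (L2 / 2 * r\<^sup>2 + A * r) * nrm (b - a)"
proof -
  have "g' \<bullet> (b - a) = (gf y - gf x - hf x (y - x)) \<bullet> (b - a) + A * ((gd x - gd y) \<bullet> (b - a))"
    by (simp add: g'_def inner_diff_left algebra_simps)
  then show ?thesis
    using gradient_residual_feasible[OF x newton_step_in_Q assms] bregman_part_inner_le[of "b - a"]
    by (simp add: r_def distrib_right)
qed

text \<open>The polarized residual bound only doubles the \<open>L2\<close> term, so the result is
  at most twice the constant for feasible directions.\<close>

lemma newton_step_gradient_dual_norm: "dual_norm nrm g' \<le> L2 * r\<^sup>2 + A * r"
proof (rule dual_norm_le[OF nrm])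
  show "0 \<le> L2 * r\<^sup>2 + A * r" using L2 A is_norm_nonneg[OF nrm] by (simp add: r_def)
  fix v
  have "g' \<bullet> v = (gf y - gf x - hf x (y - x)) \<bullet> v + A * ((gd x - gd y) \<bullet> v)"
    by (simp add: g'_def inner_diff_left algebra_simps)
  then show "g' \<bullet> v \<le> (L2 * r\<^sup>2 + A * r) * nrm v"
    using gradient_residual_full[OF x newton_step_in_Q, of v] bregman_part_inner_le[of v]
    by (simp add: r_def distrib_right)
qed

end

end

theorem theorem3:
  fixes nrm :: "'a::euclidean_space \<Rightarrow> real"
    and Q :: "'a set"
    and f psi d :: "'a \<Rightarrow> real"
    and gf gd :: "'a \<Rightarrow> 'a"
    and hf :: "'a \<Rightarrow> 'a \<Rightarrow> 'a"
    and L2 \<sigma> \<sigma>3 H :: real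
    and x Fp :: "nat \<Rightarrow> 'a"
    and xs :: 'a
  assumes nrm: "is_norm nrm"
    and Q: "convex Q" "Q \<noteq> {}"
    and psi_convex: "convex_on Q psi"
    and psi_closed: "closed {(y, t). y \<in> Q \<and> psi y \<le> t}"
    and f_convex: "convex_on UNIV f"
    and f_grad: "\<And>y. (f has_derivative (\<lambda>h. gf y \<bullet> h)) (at y)"
    and f_hess: "\<And>y. (gf has_derivative hf y) (at y)"
    and hess_cont: "\<And>v. continuous_on UNIV (\<lambda>y. hf y v)"
    and L2: "L2 \<ge> 0"
    and hess_lip: "\<And>y z. y \<in> Q \<Longrightarrow> z \<in> Q \<Longrightarrow>
                     op_norm_sa nrm (\<lambda>v. hf y v - hf z v) \<le> L2 * nrm (y - z)"
    and sigma: "0 < \<sigma>" "\<sigma> \<le> 1"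
    and d_grad: "\<And>y. (d has_derivative (\<lambda>h. gd y \<bullet> h)) (at y)"
    and d_strong: "\<And>y z. y \<in> Q \<Longrightarrow> z \<in> Q \<Longrightarrow>
                     d z \<ge> d y + gd y \<bullet> (z - y) + \<sigma> / 2 * (nrm (z - y))\<^sup>2"
    and d_lip: "\<And>y z. y \<in> Q \<Longrightarrow> z \<in> Q \<Longrightarrow>
                     dual_norm nrm (gd y - gd z) \<le> nrm (y - z)"
    and sigma3: "\<sigma>3 > 0"
    and unif_convex: "\<And>y z g. y \<in> Q \<Longrightarrow> z \<in> Q \<Longrightarrow> g \<in> subdiff Q (\<lambda>u. f u + psi u) y \<Longrightarrow>
                     f z + psi z \<ge> f y + psi y + g \<bullet> (z - y) + \<sigma>3 / 3 * (nrm (z - y)) ^ 3"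
    and H: "H \<ge> L2" "H > 0"
    and x0: "x 0 \<in> Q"
    and Fp0: "Fp 0 \<in> subdiff Q (\<lambda>u. f u + psi u) (x 0)"
    and step: "\<And>k. let A = 1 / \<sigma> * sqrt (H / 3 * dual_norm nrm (Fp k)) in
                 (if A = 0 then x (Suc k) = x k
                  else is_T Q f gf hf d gd psi A (x k) (x (Suc k)))
                 \<and> Fp (Suc k) = gf (x (Suc k)) - gf (x k) - hf (x k) (x (Suc k) - x k)
                                 - A *\<^sub>R (gd (x (Suc k)) - gd (x k))"
    and xs: "xs \<in> Q" "\<And>y. y \<in> Q \<Longrightarrow> f xs + psi xs \<le> f y + psi y"
  shows "\<forall>k. let c = 1 / \<sigma> + 3 * L2 / (2 * H);
               S = 3 * sqrt 3 / (4 * c powr (3/2)) * sqrt (\<sigma>3 / H);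
               D = Sup {nrm (y - xs) | y. y \<in> Q \<and> f y + psi y \<le> f (x 0) + psi (x 0)}
           in f (x k) + psi (x k) - (f xs + psi xs)
              \<le> D * dual_norm nrm (Fp 0)
                 * exp (- (real k * ln (1 + S)) / (sqrt c + 1/2 * ln (1 + S)))"
proof -
  interpret bregman_newton nrm Q f gf hf L2 psi d gd \<sigma>
    using nrm Q(1) f_grad f_hess hess_cont L2 hess_lip psi_convex f_convex sigma(1) d_grad d_strong d_lip
    by unfold_locales

  \<comment> \<open>Quantities attached to the iterates\<close>
  define g where "g k = dual_norm nrm (Fp k)" for k
  define a where "a k = sqrt (H / 3 * g k)" for k
  define A where "A k = 1 / \<sigma> * a k" for k
  define r where "r k = nrm (x (Suc k) - x k)" for k
  define E where "E k = F (x k) - F xs" for k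
  \<comment> \<open>The initial subgradient is not produced by a step, so its dual norm serves as
    \<open>m 0\<close>; \<open>m (Suc j)\<close> is the feasible-direction bound produced by step
    \<open>j\<close>.\<close>
  define m where "m k = (case k of 0 \<Rightarrow> g 0 | Suc j \<Rightarrow> L2 / 2 * (r j)\<^sup>2 + A j * r j)" for k
  define c where "c = 1 / \<sigma> + 3 * L2 / (2 * H)"
  define S where "S = 3 * sqrt 3 / (4 * c powr (3/2)) * sqrt (\<sigma>3 / H)"
  define D where "D = Sup {nrm (y - xs) | y. y \<in> Q \<and> F y \<le> F (x 0)}"
  have g_nonneg: "0 \<le> g k" for k unfolding g_def by (rule dual_norm_nonneg[OF nrm])
  have r_nonneg: "0 \<le> r k" for k unfolding r_def by (rule is_norm_nonneg[OF nrm])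
  have a_nonneg: "0 \<le> a k" for k unfolding a_def using H g_nonneg by simp
  have A_nonneg: "0 \<le> A k" for k unfolding A_def using a_nonneg sigma by simp
  have A_sigma: "A k * \<sigma> = a k" for k using sigma by (simp add: A_def)
  have a_sq: "a k * a k = H / 3 * g k" for k using H g_nonneg by (simp add: a_def)
  have A_eq_0: "A k = 0 \<longleftrightarrow> g k = 0" for k using sigma H by (simp add: A_def a_def)
  have m_nonneg: "0 \<le> m k" for k
    using g_nonneg r_nonneg A_nonneg L2 by (auto simp: m_def split: nat.split)
  have step_T: "is_T Q f gf hf d gd psi (A k) (x k) (x (Suc k))" if "g k > 0" for k
    using step[of k] that A_eq_0[of k] by (simp add: Let_def A_def a_def g_def)
  have step_zero: "x (Suc k) = x k" if "g k = 0" for k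
    using step[of k] that by (simp add: Let_def g_def)
  have Fp_Suc: "Fp (Suc k) = gf (x (Suc k)) - gf (x k) - hf (x k) (x (Suc k) - x k)
      - A k *\<^sub>R (gd (x (Suc k)) - gd (x k))" for k
    using step[of k] by (simp add: Let_def A_def a_def g_def)

  \<comment> \<open>Consequences of one step with nonzero subgradient\<close>
  have step_positive: "a k * r k \<le> m k" "a k * r k \<le> g k"
      "F (x (Suc k)) \<le> F (x k) - a k * (r k)\<^sup>2 + L2 / 6 * (r k) ^ 3" "F (x (Suc k)) \<le> F (x k)"
    if xk: "x k \<in> Q" and sub: "Fp k \<in> subdiff Q F (x k)"
      and feas: "\<And>u v. u \<in> Q \<Longrightarrow> v \<in> Q \<Longrightarrow> Fp k \<bullet> (v - u) \<le> m k * nrm (v - u)"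
      and gk: "0 < g k" for k
  proof -
    have Ak: "A k > 0" using A_eq_0[of k] A_nonneg[of k] gk by linarith
    note T = Ak xk sub step_T[OF gk]
    have len: "a k * (r k)\<^sup>2 \<le> Fp k \<bullet> (x k - x (Suc k))"
      using newton_step_length[OF T] by (simp add: A_sigma r_def)
    have rsym: "nrm (x k - x (Suc k)) = r k"
      using is_norm_minus_commute[OF nrm] by (simp add: r_def)
    have "a k * (r k)\<^sup>2 \<le> m k * r k"
      using len feas[OF newton_step_in_Q[OF T] xk] rsym by simp
    then show 1: "a k * r k \<le> m k"
      using r_nonneg[of k] m_nonneg[of k] by (cases "r k = 0") (auto simp: power2_eq_square)
    have "a k * (r k)\<^sup>2 \<le> g k * r k"
      using len inner_le_dual_norm[OF nrm, of "Fp k" "x k - x (Suc k)"] rsym by (simp add: g_def)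
    then show 2: "a k * r k \<le> g k"
      using r_nonneg[of k] g_nonneg[of k] by (cases "r k = 0") (auto simp: power2_eq_square)
    show 3: "F (x (Suc k)) \<le> F (x k) - a k * (r k)\<^sup>2 + L2 / 6 * (r k) ^ 3"
      using newton_step_decrease[OF T] by (simp add: A_sigma r_def)
    have "a k > 0" using Ak A_sigma[of k] sigma by (metis mult_pos_pos)
    \<comment> \<open>From \<open>a k * r k \<le> g k\<close> and the value of the square of
      \<open>a k\<close> follows \<open>L2 * r k \<le> 3 * a k\<close>: the cubic error consumes at
      most half of the decrease \<open>a k * (r k)\<^sup>2\<close>.\<close>
    have "a k * (L2 * r k) \<le> a k * (H * r k)"
      using H r_nonneg a_nonneg by (intro mult_left_mono mult_right_mono) auto
    also have "\<dots> = H * (a k * r k)" by simp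
    also have "\<dots> \<le> H * g k" using 2 H by (intro mult_left_mono) auto
    also have "\<dots> = a k * (3 * a k)" using a_sq[of k] by simp
    finally have "L2 * r k \<le> 3 * a k" using \<open>a k > 0\<close> by simp
    then have "L2 * r k * (r k)\<^sup>2 \<le> 3 * a k * (r k)\<^sup>2" by (rule mult_right_mono) simp
    moreover have "0 \<le> a k * (r k)\<^sup>2" using a_nonneg by simp
    ultimately show "F (x (Suc k)) \<le> F (x k)" using 3 by (simp add: power2_eq_square power3_eq_cube)
  qed

  \<comment> \<open>Invariants of the iteration\<close>
  have invariant: "x k \<in> Q \<and> Fp k \<in> subdiff Q F (x k) \<and> F (x k) \<le> F (x 0) \<and> g k \<le> 2 * m k
      \<and> (\<forall>u\<in>Q. \<forall>v\<in>Q. Fp k \<bullet> (v - u) \<le> m k * nrm (v - u))" for k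
  proof (induction k)
    case 0
    then show ?case using x0 Fp0 g_nonneg[of 0] inner_le_dual_norm[OF nrm, of "Fp 0"] by (simp add: m_def g_def)
  next
    case (Suc k)
    show ?case
    proof (cases "g k = 0")
      case True
      \<comment> \<open>The method has stopped: the point is repeated, the new subgradient is again
        0, and its bounds are trivial.\<close>
      then have "Fp k = 0" using dual_norm_eq_zeroD[OF nrm] by (simp add: g_def)
      moreover have "Fp (Suc k) = 0"
        using Fp_Suc[of k] step_zero[OF True] linear_0[OF bounded_linear.linear[OF hess_bounded_linear]] by simp
      moreover have "g (Suc k) \<le> 0"
        unfolding g_def \<open>Fp (Suc k) = 0\<close> by (rule dual_norm_le[OF nrm]) auto
      moreover have "0 \<le> m (Suc k) * nrm v" for v
        using m_nonneg[of "Suc k"] is_norm_nonneg[OF nrm, of v] by simp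
      ultimately show ?thesis using Suc step_zero[OF True] m_nonneg[of "Suc k"] by auto
    next
      case False
      then have gk: "g k > 0" using g_nonneg[of k] by simp
      have Ak: "A k > 0" using A_eq_0[of k] A_nonneg[of k] gk by linarith
      have xk: "x k \<in> Q" and sub: "Fp k \<in> subdiff Q F (x k)" using Suc by auto
      note T = Ak xk sub step_T[OF gk]
      have mS: "m (Suc k) = L2 / 2 * (r k)\<^sup>2 + A k * r k" by (simp add: m_def)
      have "F (x (Suc k)) \<le> F (x k)" using step_positive(4)[OF xk sub _ gk] Suc by blast
      moreover have "g (Suc k) \<le> L2 * (r k)\<^sup>2 + A k * r k"
        using newton_step_gradient_dual_norm[OF T] by (simp add: g_def r_def Fp_Suc)
      moreover have "0 \<le> A k * r k" using Ak r_nonneg[of k] by simp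
      moreover have "Fp (Suc k) \<in> subdiff Q F (x (Suc k))"
        using newton_step_subgradient[OF T] by (simp only: Fp_Suc)
      moreover have "Fp (Suc k) \<bullet> (v - u) \<le> m (Suc k) * nrm (v - u)" if "u \<in> Q" "v \<in> Q" for u v
        using newton_step_gradient_feasible[OF T that] by (simp only: Fp_Suc mS r_def)
      ultimately show ?thesis using newton_step_in_Q[OF T] Suc mS by auto
    qed
  qed
  have xQ: "x k \<in> Q" and sub: "Fp k \<in> subdiff Q F (x k)" and level: "F (x k) \<le> F (x 0)"
    and g_le: "g k \<le> 2 * m k"
    and feas: "\<And>u v. u \<in> Q \<Longrightarrow> v \<in> Q \<Longrightarrow> Fp k \<bullet> (v - u) \<le> m k * nrm (v - u)" for k
    using invariant[of k] by auto

  \<comment> \<open>Bounds on the gap by uniform convexity and by the diameter\<close>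
  have cubic: "E k \<le> m k * nrm (xs - x k) - \<sigma>3 / 3 * (nrm (xs - x k)) ^ 3" for k
  proof -
    have "Fp k \<bullet> (x k - xs) \<le> m k * nrm (xs - x k)"
      using feas[OF xs(1) xQ, of k k] is_norm_minus_commute[OF nrm] by metis
    then show ?thesis using unif_convex[OF xQ xs(1) sub, of k]
      by (simp add: E_def inner_diff_right)
  qed
  have E_le_m32: "E k \<le> 2 / (3 * sqrt \<sigma>3) * (m k * sqrt (m k))" for k
    using cubic[of k] cubic_young[OF m_nonneg is_norm_nonneg[OF nrm] sigma3, of k "xs - x k"] by linarith
  have E_nonneg: "0 \<le> E k" for k using xs(2)[OF xQ] by (simp add: E_def)

  \<comment> \<open>Since 0 is a subgradient at the minimizer, uniform convexity bounds the cube of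
    the distance to it on the level set. The maximum with 1 allows passing from the cube to the
    distance itself.\<close>
  have bdd: "bdd_above {nrm (y - xs) | y. y \<in> Q \<and> F y \<le> F (x 0)}"
  proof (rule bdd_aboveI[of _ "max 1 (3 / \<sigma>3 * (F (x 0) - F xs))"], clarify)
    fix y assume y: "y \<in> Q" "F y \<le> F (x 0)"
    have "0 \<in> subdiff Q F xs" using xs(2) by (simp add: subdiff_def)
    from unif_convex[OF xs(1) y(1) this] y(2)
    have le: "(nrm (y - xs)) ^ 3 \<le> 3 / \<sigma>3 * (F (x 0) - F xs)"
      using sigma3 by (simp add: field_simps)
    show "nrm (y - xs) \<le> max 1 (3 / \<sigma>3 * (F (x 0) - F xs))"
    proof (cases "nrm (y - xs) \<le> 1")
      case False
      then have "nrm (y - xs) \<le> (nrm (y - xs)) ^ 3" by (intro self_le_power) auto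
      then show ?thesis using le by linarith
    qed simp
  qed
  have nrm_le_D: "nrm (x k - xs) \<le> D" for k
    unfolding D_def by (rule cSup_upper[OF _ bdd]) (use xQ level in blast)
  have D_nonneg: "0 \<le> D" using nrm_le_D[of 0] is_norm_nonneg[OF nrm, of "x 0 - xs"] by linarith
  have E_le_D: "E k \<le> D * m k" for k
  proof -
    have "E k \<le> m k * nrm (xs - x k)"
      using cubic[of k] sigma3 is_norm_nonneg[OF nrm, of "xs - x k"]
      by (smt (verit) divide_nonneg_pos mult_nonneg_nonneg zero_le_power)
    also have "\<dots> \<le> m k * D"
      using nrm_le_D[of k] is_norm_minus_commute[OF nrm, of xs "x k"] m_nonneg[of k]
      by (intro mult_left_mono) auto
    finally show ?thesis by (simp add: mult.commute)
  qed

  have c_pos: "c > 0" using sigma L2 H by (simp add: c_def add_pos_nonneg)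
  have S_pos: "S > 0" using c_pos sigma3 H by (simp add: S_def)
  have m_pos: "m k > 0" if "E k > 0" for k
    using E_le_D[of k] that m_nonneg[of k] by (cases "m k = 0") auto

  \<comment> \<open>Accumulated logarithmic decrease\<close>
  have potential: "ln (1 + S) / sqrt c * (real k + 1/2 * (ln (m k) - ln (m 0))) \<le> ln (E 0) - ln (E k)
      \<and> 0 < E 0" if "0 < E k" for k
    using that
  proof (induction k)
    case (Suc k)
    \<comment> \<open>A zero subgradient would make \<open>x k\<close> a minimizer that the method
      repeats, contradicting a positive gap at \<open>Suc k\<close>.\<close>
    have gk: "g k > 0"
    proof (rule ccontr)
      assume "\<not> g k > 0"
      then have 0: "g k = 0" using g_nonneg[of k] by simp
      then have "Fp k = 0" using dual_norm_eq_zeroD[OF nrm] by (simp add: g_def)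
      then have "F (x k) \<le> F xs" using sub[of k] xs(1) by (auto simp: subdiff_def)
      then show False using Suc.prems step_zero[OF 0] by (simp add: E_def)
    qed
    note st = step_positive[OF xQ sub feas gk]
    have Ek: "0 < E k" using st(4) Suc.prems by (simp add: E_def)
    have mS: "m (Suc k) = L2 / 2 * (r k)\<^sup>2 + 1 / \<sigma> * a k * r k" by (simp add: m_def A_def)
    have rk: "r k > 0"
      using m_pos[OF Suc.prems] r_nonneg[of k] mS by (cases "r k = 0") auto
    have "ln (1 + S) / sqrt c * (1 + 1/2 * ln (m (Suc k) / m k)) \<le> ln (E k) - ln (E (Suc k))"
      unfolding mS S_def c_def a_def
      by (rule log_decrease)
         (use sigma L2 H sigma3 gk rk st(1-3) g_le[of k] Suc.prems E_le_m32[of "Suc k"] in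
           \<open>simp_all add: a_def mS E_def\<close>)
    moreover have "ln (m (Suc k) / m k) = ln (m (Suc k)) - ln (m k)"
      using m_pos[OF Suc.prems] m_pos[OF Ek] by (simp add: ln_div)
    ultimately have "ln (1 + S) / sqrt c * (1 + 1/2 * (ln (m (Suc k)) - ln (m k)))
        + ln (1 + S) / sqrt c * (real k + 1/2 * (ln (m k) - ln (m 0))) \<le> ln (E 0) - ln (E (Suc k))"
      using Suc.IH[OF Ek] by simp
    moreover have "ln (1 + S) / sqrt c * (1 + 1/2 * (ln (m (Suc k)) - ln (m k)))
        + ln (1 + S) / sqrt c * (real k + 1/2 * (ln (m k) - ln (m 0)))
        = ln (1 + S) / sqrt c * (real (Suc k) + 1/2 * (ln (m (Suc k)) - ln (m 0)))"
      unfolding distrib_left[symmetric]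
      by (rule arg_cong[where f = "\<lambda>t. ln (1 + S) / sqrt c * t"]) (simp add: field_simps)
    ultimately show ?case using Suc.IH[OF Ek] by simp
  qed simp

  \<comment> \<open>Conversion to the exponential rate\<close>
  have "E k \<le> D * g 0 * exp (- (real k * ln (1 + S)) / (sqrt c + 1/2 * ln (1 + S)))" for k
  proof (cases "E k = 0")
    case True
    then show ?thesis using D_nonneg g_nonneg[of 0] by simp
  next
    case False
    then have Ek: "E k > 0" using E_nonneg[of k] by simp
    have E0: "E 0 > 0" using potential[OF Ek] by simp
    have m0: "m 0 = g 0" by (simp add: m_def)
    have B: "D * g 0 > 0" using E_le_D[of 0] E0 m0 by simp
    have "D > 0" using B D_nonneg by (simp add: zero_less_mult_iff)
    \<comment> \<open>The bound \<open>E k \<le> D * m k\<close> removes \<open>m k\<close> from the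
      potential: \<open>D\<close> cancels against the one in \<open>D * g 0\<close>, and only the
      gap itself is left.\<close>
    have "ln (E k) \<le> ln (D * m k)" using E_le_D[of k] Ek by simp
    then have "ln (E k) - ln (D * g 0) \<le> ln (m k) - ln (m 0)"
      using \<open>D > 0\<close> m_pos[OF Ek] m_pos[OF E0] by (simp add: ln_mult m0)
    then have "ln (1 + S) / sqrt c * (real k + 1/2 * (ln (E k) - ln (D * g 0)))
        \<le> ln (1 + S) / sqrt c * (real k + 1/2 * (ln (m k) - ln (m 0)))"
      using S_pos c_pos by (intro mult_left_mono) auto
    also have "\<dots> \<le> ln (E 0) - ln (E k)" using potential[OF Ek] by simp
    also have "\<dots> \<le> ln (D * g 0) - ln (E k)" using E_le_D[of 0] E0 m0 by simp
    finally show ?thesis using Ek B S_pos c_pos by (intro exp_rate_of_log_potential) auto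
  qed
  then show ?thesis by (simp add: Let_def E_def D_def g_def S_def c_def)
qed

end
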